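(* Let $P=\sum_{\alpha\in\mathbb{N}^n}a_\alpha(t)\mathbf{z}^\alpha\in\mathbb{C}\{t\}[z_1,\ldots,z_n]$ and suppose that $\operatorname{supp}(P)$ has constant parity. If $P$ has the half-plane property, then $\operatorname{trop}(P)$ is an $M$-concave function.
   Context: $\mathbb{R}\{t\}$ denotes the real field of generalized Puiseux series, i.e. formal series $x(t)=\sum_{-k\in A}a_k t^k$ with $A\subset\mathbb{R}$ well ordered and $a_k\in\mathbb{R}$. $\mathbb{C}\{t\}=\{x+iy: x,y\in\mathbb{R}\{t\}\}$, with $\Re(x+iy)=x$, $\Im(x+iy)=y$. The valuation $\nu:\mathbb{C}\{t\}\to\mathbb{R}\cup\{-\infty\}$ sends a series to its leading (largest) exponent, with $\nu(0)=-\infty$. A real series is positive if its leading coefficient is positive. For $\theta\in\mathbb{R}$ let $H_\theta=\{z\in\mathbb{C}\{t\}:\Im(e^{i\theta}z)>0\}$. A polynomial $P\in\mathbb{C}\{t\}[\mathbf{z}]$ is $H_\theta$-stable if $P(\mathbf{z})\neq0$ whenever all $z_j\in H_\theta$; it has the half-plane property if it is $H_\theta$-stable for some $\theta\in\mathbb{R}$. The support of $P=\sum a_\alpha(t)\mathbf{z}^\alpha$ is $\operatorname{supp}(P)=\{\alpha: a_\alpha(t)\neq0\}$, and $\operatorname{trop}(P):\operatorname{supp}(P)\to\mathbb{R}$ is $\alpha\mapsto\nu(a_\alpha(t))$. For $\alpha\in\mathbb{Z}^n$ let $|\alpha|=\sum_i|\alpha_i|$. A set $\mathcal{A}\subseteq\mathbb{Z}^n$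 has constant parity if $|\alpha|-|\beta|$ is even for all $\alpha,\beta\in\mathcal{A}$. For $\alpha,\beta\in\mathbb{Z}^n$, a step from $\alpha$ to $\beta$ is $s\in\mathbb{Z}^n$ with $|s|=1$ and $|\alpha+s-\beta|=|\alpha-\beta|-1$; write $\alpha\xrightarrow{s}\beta$. A function $f:\mathcal{J}\to\mathbb{R}$, $\mathcal{J}\subseteq\mathbb{Z}^n$, is $M$-concave if for all $\alpha,\beta\in\mathcal{J}$ and every step $s$ with $\alpha\xrightarrow{s}\beta$ there is a step $t$ with $\alpha+s\xrightarrow{t}\beta$, $\alpha+s+t\in\mathcal{J}$, $\beta-s-t\in\mathcal{J}$ and $f(\alpha)+f(\beta)\le f(\alpha+s+t)+f(\beta-s-t)$. *)

theory Defs
  imports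
    "HOL-Analysis.Analysis"
    "HOL-Library.Poly_Mapping"
begin

section \<open>Well-ordered sets of reals\<close>

lemma wo_real_iff_min:
  fixes A :: "real set"
  shows "wfp_on A (<) \<longleftrightarrow> (\<forall>B\<subseteq>A. B \<noteq> {} \<longrightarrow> (\<exists>m\<in>B. \<forall>b\<in>B. m \<le> b))"
proof -
  have "(\<forall>y. y < m \<longrightarrow> y \<notin> B) \<longleftrightarrow> (\<forall>b\<in>B. m \<le> b)" for m :: real and B
    by (auto simp: not_less[symmetric])
  then show ?thesis unfolding wfp_on_iff_ex_minimal by simp
qed

lemma wo_real_minE:
  fixes A :: "real set"
  assumes "wfp_on A (<)" "B \<subseteq> A" "B \<noteq> {}"
  obtains m where "m \<in> B" "\<And>b. b \<in> B \<Longrightarrow> m \<le> b"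
proof -
  have "\<exists>m\<in>B. \<forall>b\<in>B. m \<le> b"
    using assms(1)[unfolded wo_real_iff_min, rule_format, OF assms(2,3)] by simp
  then show thesis using that by blast
qed

lemma wo_real_no_descending:
  fixes A :: "real set"
  assumes "wfp_on A (<)" "\<And>n. s n \<in> A" "\<And>n. s (Suc n) < s n"
  shows False
proof -
  obtain m where m: "m \<in> range s" "\<And>b. b \<in> range s \<Longrightarrow> m \<le> b"
    using wo_real_minE[OF assms(1), of "range s"] assms(2) by blast
  then obtain n where "m = s n" by blast
  with m(2)[of "s (Suc n)"] assms(3)[of n] show False by simp
qed

lemma wo_real_of_no_descending:
  fixes A :: "real set"
  assumes "\<And>s :: nat \<Rightarrow> real. (\<And>n. s n \<in> A) \<Longrightarrow> (\<And>n. s (Suc n) < s n) \<Longrightarrow> False"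
  shows "wfp_on A (<)"
proof (rule ccontr)
  assume "\<not> wfp_on A (<)"
  then obtain B where B: "B \<subseteq> A" "B \<noteq> {}" "\<And>m. m \<in> B \<Longrightarrow> \<exists>b\<in>B. b < m"
    unfolding wo_real_iff_min by (meson not_le)
  from B(2) obtain b0 where b0: "b0 \<in> B" by blast
  define s where "s = rec_nat b0 (\<lambda>_ m. SOME b. b \<in> B \<and> b < m)"
  have s0: "s 0 = b0" and sS: "s (Suc n) = (SOME b. b \<in> B \<and> b < s n)" for n
    by (simp_all add: s_def)
  have ex: "m \<in> B \<Longrightarrow> (SOME b. b \<in> B \<and> b < m) \<in> B \<and> (SOME b. b \<in> B \<and> b < m) < m" for m
    using someI_ex[of "\<lambda>b. b \<in> B \<and> b < m"] B(3)[of m] by blast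
  have inB: "s n \<in> B" for n
  proof (induction n)
    case 0
    show ?case using b0 by (simp only: s0)
  next
    case (Suc n)
    show ?case unfolding sS using ex[OF Suc] by (rule conjunct1)
  qed
  have "s (Suc n) < s n" for n
    unfolding sS using ex[OF inB[of n]] by (rule conjunct2)
  then show False using assms[of s] inB B(1) by blast
qed

lemma wo_real_mono_subseq:
  fixes A :: "real set" and s :: "nat \<Rightarrow> real"
  assumes "wfp_on A (<)" "\<And>n. s n \<in> A"
  obtains r :: "nat \<Rightarrow> nat" where "strict_mono r" "incseq (s \<circ> r)"
proof -
  obtain f :: "nat \<Rightarrow> nat" where f: "strict_mono f" "monoseq (\<lambda>n. s (f n))"
    using seq_monosub by blast
  from f(2) consider "incseq (s \<circ> f)" | "decseq (s \<circ> f)"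
    by (auto simp: monoseq_iff o_def)
  then show ?thesis
  proof cases
    case 1
    with f(1) that show ?thesis by blast
  next
    case 2
    obtain m where m: "m \<in> range (s \<circ> f)" "\<And>b. b \<in> range (s \<circ> f) \<Longrightarrow> m \<le> b"
      using wo_real_minE[OF assms(1), of "range (s \<circ> f)"] assms(2) by (auto simp: image_subset_iff)
    then obtain N where N: "m = s (f N)" by auto
    have const: "s (f (n + N)) = m" for n
      using m(2)[of "s (f (n + N))"] decseqD[OF 2, of N "n + N"] N by auto
    show ?thesis
    proof (rule that)
      show "strict_mono (\<lambda>n. f (n + N))"
        using f(1) by (simp add: strict_mono_def)
      show "incseq (s \<circ> (\<lambda>n. f (n + N)))"
        by (simp add: incseq_def const)
    qed
  qed
qed

lemma wo_real_union:
  fixes A B :: "real set"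
  assumes "wfp_on A (<)" "wfp_on B (<)"
  shows "wfp_on (A \<union> B) (<)"
  unfolding wo_real_iff_min
proof (intro allI impI)
  fix C assume C: "C \<subseteq> A \<union> B" "C \<noteq> {}"
  show "\<exists>m\<in>C. \<forall>b\<in>C. m \<le> b"
  proof (cases "C \<inter> A = {} \<or> C \<inter> B = {}")
    case True
    with C have "C \<subseteq> A \<or> C \<subseteq> B" by blast
    with C(2) assms show ?thesis unfolding wo_real_iff_min by blast
  next
    case False
    obtain m where m: "m \<in> C \<inter> A" "\<And>b. b \<in> C \<inter> A \<Longrightarrow> m \<le> b"
      using wo_real_minE[OF assms(1), of "C \<inter> A"] False by blast
    obtain k where k: "k \<in> C \<inter> B" "\<And>b. b \<in> C \<inter> B \<Longrightarrow> k \<le> b"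
      using wo_real_minE[OF assms(2), of "C \<inter> B"] False by blast
    have "min m k \<in> C" using m k by (simp add: min_def)
    moreover have "\<forall>b\<in>C. min m k \<le> b"
      using C(1) m(2) k(2) by (auto simp: min_le_iff_disj)
    ultimately show ?thesis by blast
  qed
qed

lemma wo_real_sums:
  fixes A B :: "real set"
  assumes "wfp_on A (<)" "wfp_on B (<)"
  shows "wfp_on {a + b | a b. a \<in> A \<and> b \<in> B} (<)"
proof (rule wo_real_of_no_descending)
  fix s :: "nat \<Rightarrow> real"
  assume s: "\<And>n. s n \<in> {a + b | a b. a \<in> A \<and> b \<in> B}" "\<And>n. s (Suc n) < s n"
  have "\<exists>p. fst p \<in> A \<and> snd p \<in> B \<and> s n = fst p + snd p" for n
    using s(1)[of n] by fastforce
  then obtain p where p: "\<And>n. fst (p n) \<in> A \<and> snd (p n) \<in> B \<and> s n = fst (p n) + snd (p n)"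
    by metis
  obtain r where r: "strict_mono r" "incseq ((\<lambda>n. fst (p n)) \<circ> r)"
    using wo_real_mono_subseq[OF assms(1), of "\<lambda>n. fst (p n)"] p by blast
  have dec: "s j < s i" if "i < j" for i j
    using lift_Suc_mono_less[of "\<lambda>n. - s n" i j] that s(2) by simp
  have "snd (p (r (Suc n))) < snd (p (r n))" for n
  proof -
    have "s (r (Suc n)) < s (r n)"
      using dec r(1) by (simp add: strict_mono_def)
    moreover have "fst (p (r n)) \<le> fst (p (r (Suc n)))"
      using incseqD[OF r(2), of n "Suc n"] by simp
    ultimately show ?thesis using p[of "r n"] p[of "r (Suc n)"] by linarith
  qed
  then show False
    using wo_real_no_descending[OF assms(2), of "\<lambda>n. snd (p (r n))"] p by blast
qed

lemma finite_wo_real_fibre: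
  fixes A B :: "real set"
  assumes "wfp_on A (<)" "wfp_on B (<)"
  shows "finite {a. a \<in> A \<and> c - a \<in> B}"
proof (rule ccontr)
  assume "infinite {a. a \<in> A \<and> c - a \<in> B}"
  then obtain s :: "nat \<Rightarrow> real" where s: "inj s" "range s \<subseteq> {a. a \<in> A \<and> c - a \<in> B}"
    using infinite_countable_subset by blast
  obtain r where r: "strict_mono r" "incseq (s \<circ> r)"
    using wo_real_mono_subseq[OF assms(1), of s] s(2) by blast
  have "s (r n) < s (r (Suc n))" for n
  proof -
    have "r n \<noteq> r (Suc n)" using r(1) by (metis n_not_Suc_n strict_mono_eq)
    then have "s (r n) \<noteq> s (r (Suc n))" using s(1) by (simp add: inj_eq)
    with incseqD[OF r(2), of n "Suc n"] show ?thesis by simp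
  qed
  then have "c - s (r (Suc n)) < c - s (r n)" for n
    by simp
  moreover have "c - s (r n) \<in> B" for n
    using s(2) by blast
  ultimately show False
    by (rule wo_real_no_descending[OF assms(2), rotated])
qed


section \<open>Generalized Puiseux series\<close>

text \<open>
  An element is its family of coefficients: \<^term>\<open>f k\<close> is the coefficient of \<open>t\<^sup>k\<close>, and the set
  of negated exponents is well ordered, so that there is a \<^emph>\<open>largest\<close> exponent. The real field
  \<open>\<real>{t}\<close> is \<open>real puiseux\<close>. The field \<open>\<complex>{t}\<close> is \<open>complex puiseux\<close>; that its elements are exactly
  the \<open>x + iy\<close> with \<open>x, y\<close> in \<open>\<real>{t}\<close>, uniquely so, is shown below.
\<close>

typedef (overloaded) 'a puiseux =
  "{f :: real \<Rightarrow> 'a::zero. wfp_on {k. f (- k) \<noteq> 0} (<)}"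
  morphisms pcoeff Abs_puiseux
  by (rule exI[of _ "\<lambda>_. 0"]) (simp add: wo_real_iff_min)

setup_lifting type_definition_puiseux

lemma puiseux_eqI: "(\<And>k. pcoeff x k = pcoeff y k) \<Longrightarrow> x = y"
  by (simp add: pcoeff_inject[symmetric] fun_eq_iff)

lemma wo_pcoeff: "wfp_on {k. pcoeff x (- k) \<noteq> 0} (<)"
  using pcoeff[of x] by simp

lemma wo_support_map:
  assumes "wfp_on {k::real. f (- k) \<noteq> 0} (<)" "g 0 = 0"
  shows "wfp_on {k. g (f (- k)) \<noteq> 0} (<)"
  by (rule wfp_on_subset[OF assms(1)]) (use assms(2) in auto)

lemma wo_support_add:
  fixes f g :: "real \<Rightarrow> 'a::monoid_add"
  assumes "wfp_on {k. f (- k) \<noteq> 0} (<)" "wfp_on {k. g (- k) \<noteq> 0} (<)"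
  shows "wfp_on {k. f (- k) + g (- k) \<noteq> 0} (<)"
  by (rule wfp_on_subset[OF wo_real_union[OF assms]]) auto

lemma wo_support_single: "wfp_on {k::real. (if - k = e then c else 0) \<noteq> 0} (<)"
proof -
  have "wfp_on {- e} (<)" by (simp add: wfp_on_def)
  then show ?thesis by (rule wfp_on_subset) (auto split: if_splits)
qed

lemma finite_support_fibre:
  fixes f g :: "real \<Rightarrow> 'a::zero"
  assumes "wfp_on {k. f (- k) \<noteq> 0} (<)" "wfp_on {k. g (- k) \<noteq> 0} (<)"
  shows "finite {i. f i \<noteq> 0 \<and> g (k - i) \<noteq> 0}"
proof -
  let ?S = "{a. a \<in> {k. f (- k) \<noteq> 0} \<and> - k - a \<in> {k. g (- k) \<noteq> 0}}"
  have "{i. f i \<noteq> 0 \<and> g (k - i) \<noteq> 0} \<subseteq> uminus ` ?S"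
  proof
    fix i assume "i \<in> {i. f i \<noteq> 0 \<and> g (k - i) \<noteq> 0}"
    then show "i \<in> uminus ` ?S" by (intro image_eqI[of _ _ "- i"]) simp_all
  qed
  moreover have "finite (uminus ` ?S)"
    using finite_wo_real_fibre[OF assms, of "- k"] by (rule finite_imageI)
  ultimately show ?thesis by (rule finite_subset)
qed

lemma wo_support_mult:
  fixes f g :: "real \<Rightarrow> 'a::semiring_0"
  assumes "wfp_on {k. f (- k) \<noteq> 0} (<)" "wfp_on {k. g (- k) \<noteq> 0} (<)"
  shows "wfp_on {k. (\<Sum>i | f i \<noteq> 0 \<and> g (- k - i) \<noteq> 0. f i * g (- k - i)) \<noteq> 0} (<)"
proof (rule wfp_on_subset[OF wo_real_sums[OF assms]], rule subsetI)
  fix k assume "k \<in> {k. (\<Sum>i | f i \<noteq> 0 \<and> g (- k - i) \<noteq> 0. f i * g (- k - i)) \<noteq> 0}"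
  then obtain i where "f i \<noteq> 0" "g (- k - i) \<noteq> 0"
    by (auto elim: sum.not_neutral_contains_not_neutral)
  moreover have "- (k + i) = - k - i" by simp
  ultimately have "k = - i + (k + i) \<and> - i \<in> {k. f (- k) \<noteq> 0} \<and> k + i \<in> {k. g (- k) \<noteq> 0}"
    by (simp only: mem_Collect_eq minus_minus) simp
  then show "k \<in> {a + b | a b. a \<in> {k. f (- k) \<noteq> 0} \<and> b \<in> {k. g (- k) \<noteq> 0}}"
    by blast
qed

lift_definition pmono :: "'a::zero \<Rightarrow> real \<Rightarrow> 'a puiseux"
  is "\<lambda>c e k. if k = e then c else 0"
  by (rule wo_support_single)

abbreviation pconst :: "'a::zero \<Rightarrow> 'a puiseux"
  where "pconst c \<equiv> pmono c 0"

instantiation puiseux :: (comm_ring_1) comm_ring_1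
begin

lift_definition zero_puiseux :: "'a puiseux" is "\<lambda>_. 0"
  by (simp add: wo_real_iff_min)

lift_definition one_puiseux :: "'a puiseux" is "\<lambda>k. if k = 0 then 1 else 0"
  by (rule wo_support_single)

lift_definition plus_puiseux :: "'a puiseux \<Rightarrow> 'a puiseux \<Rightarrow> 'a puiseux"
  is "\<lambda>f g k. f k + g k"
  by (rule wo_support_add)

lift_definition uminus_puiseux :: "'a puiseux \<Rightarrow> 'a puiseux" is "\<lambda>f k. - f k"
  by simp

definition minus_puiseux :: "'a puiseux \<Rightarrow> 'a puiseux \<Rightarrow> 'a puiseux"
  where "minus_puiseux x y = x + - y"

lift_definition times_puiseux :: "'a puiseux \<Rightarrow> 'a puiseux \<Rightarrow> 'a puiseux"
  is "\<lambda>f g k. \<Sum>i | f i \<noteq> 0 \<and> g (k - i) \<noteq> 0. f i * g (k - i)"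
  by (rule wo_support_mult)

lemma pcoeff_times_superset:
  fixes x y :: "'a puiseux"
  assumes "finite S" "{i. pcoeff x i \<noteq> 0 \<and> pcoeff y (k - i) \<noteq> 0} \<subseteq> S"
  shows "pcoeff (x * y) k = (\<Sum>i\<in>S. pcoeff x i * pcoeff y (k - i))"
  unfolding times_puiseux.rep_eq
  by (rule sum.mono_neutral_left[OF assms]) auto

lemma finite_pcoeff_fibre:
  fixes x y :: "'a puiseux"
  shows "finite {i. pcoeff x i \<noteq> 0 \<and> pcoeff y (k - i) \<noteq> 0}"
  by (rule finite_support_fibre[OF wo_pcoeff wo_pcoeff])

lemma puiseux_mult_commute: "x * y = y * x" for x y :: "'a puiseux"
proof (rule puiseux_eqI)
  fix k
  show "pcoeff (x * y) k = pcoeff (y * x) k"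
    unfolding times_puiseux.rep_eq
    by (rule sum.reindex_bij_witness[of _ "\<lambda>i. k - i" "\<lambda>i. k - i"]) (auto simp: mult.commute)
qed

lemma puiseux_distrib: "(x + y) * z = x * z + y * z" for x y z :: "'a puiseux"
proof (rule puiseux_eqI)
  fix k
  let ?S = "{i. pcoeff x i \<noteq> 0 \<and> pcoeff z (k - i) \<noteq> 0} \<union> {i. pcoeff y i \<noteq> 0 \<and> pcoeff z (k - i) \<noteq> 0}"
  have fin: "finite ?S" using finite_pcoeff_fibre by blast
  have "pcoeff ((x + y) * z) k = (\<Sum>i\<in>?S. pcoeff (x + y) i * pcoeff z (k - i))"
    by (rule pcoeff_times_superset[OF fin]) (auto simp: plus_puiseux.rep_eq)
  moreover have "pcoeff (x * z) k = (\<Sum>i\<in>?S. pcoeff x i * pcoeff z (k - i))"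
    by (rule pcoeff_times_superset[OF fin]) auto
  moreover have "pcoeff (y * z) k = (\<Sum>i\<in>?S. pcoeff y i * pcoeff z (k - i))"
    by (rule pcoeff_times_superset[OF fin]) auto
  ultimately show "pcoeff ((x + y) * z) k = pcoeff (x * z + y * z) k"
    by (simp add: plus_puiseux.rep_eq distrib_right sum.distrib)
qed

lemma puiseux_mult_triple:
  fixes x y z :: "'a puiseux"
  shows "pcoeff (x * y * z) k =
    (\<Sum>(i, j) | pcoeff x i \<noteq> 0 \<and> pcoeff y j \<noteq> 0 \<and> pcoeff z (k - i - j) \<noteq> 0.
       pcoeff x i * pcoeff y j * pcoeff z (k - i - j))"
proof -
  let ?A = "\<lambda>x::'a puiseux. {k. pcoeff x (- k) \<noteq> 0}"
  let ?T = "{a + b | a b. a \<in> ?A x \<and> b \<in> ?A y}"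
  let ?M = "uminus ` {a. a \<in> ?T \<and> - k - a \<in> ?A z}"
  let ?F = "\<lambda>m. {i. pcoeff x i \<noteq> 0 \<and> pcoeff y (m - i) \<noteq> 0}"
  have finM: "finite ?M"
    using finite_wo_real_fibre[OF wo_real_sums[OF wo_pcoeff wo_pcoeff] wo_pcoeff] by blast
  have memM: "m \<in> ?M \<longleftrightarrow> ?F m \<noteq> {} \<and> pcoeff z (k - m) \<noteq> 0" for m
  proof
    assume "m \<in> ?M"
    then obtain c where c: "m = - c" "c \<in> ?T" "- k - c \<in> ?A z" by blast
    from c(2) obtain a b where ab: "c = a + b" "a \<in> ?A x" "b \<in> ?A y" by blast
    have "- (- k - c) = k - m" using c(1) by simp
    with c ab have *: "m = - (a + b)" "pcoeff x (- a) \<noteq> 0" "pcoeff y (- b) \<noteq> 0"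
        "pcoeff z (k - m) \<noteq> 0"
      by (simp_all only: mem_Collect_eq not_False_eq_True)
    then have "- a \<in> ?F m" by simp
    with * show "?F m \<noteq> {} \<and> pcoeff z (k - m) \<noteq> 0" by blast
  next
    assume "?F m \<noteq> {} \<and> pcoeff z (k - m) \<noteq> 0"
    then obtain i where i: "pcoeff x i \<noteq> 0" "pcoeff y (m - i) \<noteq> 0" "pcoeff z (k - m) \<noteq> 0"
      by blast
    then have "- m = - i + (i - m) \<and> - i \<in> ?A x \<and> i - m \<in> ?A y" by simp
    then have "- m \<in> ?T" by blast
    with i(3) have "- m \<in> {a. a \<in> ?T \<and> - k - a \<in> ?A z}" by simp
    then show "m \<in> ?M" by (rule image_eqI[rotated]) simp
  qed
  have M_eq: "?M = {m. ?F m \<noteq> {} \<and> pcoeff z (k - m) \<noteq> 0}"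
    by (rule set_eqI, unfold mem_Collect_eq, rule memM[unfolded mem_Collect_eq])
  have "pcoeff (x * y * z) k = (\<Sum>m\<in>?M. pcoeff (x * y) m * pcoeff z (k - m))"
  proof (rule pcoeff_times_superset[OF finM], rule subsetI)
    fix m assume m: "m \<in> {i. pcoeff (x * y) i \<noteq> 0 \<and> pcoeff z (k - i) \<noteq> 0}"
    then have "(\<Sum>i\<in>?F m. pcoeff x i * pcoeff y (m - i)) \<noteq> 0" by (simp add: times_puiseux.rep_eq)
    then have "?F m \<noteq> {}" by (metis sum.empty)
    with m show "m \<in> ?M" unfolding memM by simp
  qed
  also have "\<dots> = (\<Sum>m\<in>?M. \<Sum>i\<in>?F m. pcoeff x i * pcoeff y (m - i) * pcoeff z (k - m))"
    by (simp add: times_puiseux.rep_eq sum_distrib_right)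
  also have "\<dots> = (\<Sum>(m, i)\<in>Sigma ?M ?F. pcoeff x i * pcoeff y (m - i) * pcoeff z (k - m))"
    by (rule sum.Sigma) (use finM finite_pcoeff_fibre in auto)
  also have "\<dots> = (\<Sum>(i, j) | pcoeff x i \<noteq> 0 \<and> pcoeff y j \<noteq> 0 \<and> pcoeff z (k - i - j) \<noteq> 0.
       pcoeff x i * pcoeff y j * pcoeff z (k - i - j))"
    unfolding M_eq
    by (rule sum.reindex_bij_witness[of _ "\<lambda>(i, j). (i + j, i)" "\<lambda>(m, i). (i, m - i)"])
      (force simp: diff_diff_eq)+
  finally show ?thesis .
qed

lemma puiseux_mult_assoc: "x * y * z = x * (y * z)" for x y z :: "'a puiseux"
proof (rule puiseux_eqI)
  fix k
  have "pcoeff (x * (y * z)) k = pcoeff (y * z * x) k" by (simp add: puiseux_mult_commute)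
  also have "\<dots> = pcoeff (x * y * z) k"
    unfolding puiseux_mult_triple
    by (rule sum.reindex_bij_witness[of _ "\<lambda>(i, j). (j, k - i - j)" "\<lambda>(i, j). (k - i - j, i)"])
      (auto simp: algebra_simps)
  finally show "pcoeff (x * y * z) k = pcoeff (x * (y * z)) k" by simp
qed

lemma pcoeff_pmono_times:
  fixes x :: "'a puiseux"
  shows "pcoeff (pmono c e * x) k = c * pcoeff x (k - e)"
  by (subst pcoeff_times_superset[of "{e}"]) (auto simp: pmono.rep_eq split: if_splits)

lemma puiseux_one_mult: "1 * x = x" for x :: "'a puiseux"
proof (rule puiseux_eqI)
  fix k
  have "pcoeff (1 * x) k = (\<Sum>i\<in>{0}. pcoeff 1 i * pcoeff x (k - i))"
    by (rule pcoeff_times_superset) (auto simp: one_puiseux.rep_eq split: if_splits)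
  then show "pcoeff (1 * x) k = pcoeff x k"
    by (simp add: one_puiseux.rep_eq)
qed

instance
proof
  fix x y z :: "'a puiseux"
  show "x + y + z = x + (y + z)" by transfer (simp add: add.assoc)
  show "x + y = y + x" by transfer (simp add: add.commute)
  show "0 + x = x" by transfer simp
  show "- x + x = 0" by transfer simp
  show "x - y = x + - y" by (simp add: minus_puiseux_def)
  show "x * y * z = x * (y * z)" by (rule puiseux_mult_assoc)
  show "x * y = y * x" by (rule puiseux_mult_commute)
  show "(x + y) * z = x * z + y * z" by (rule puiseux_distrib)
  show "1 * x = x" by (rule puiseux_one_mult)
  show "(0 :: 'a puiseux) \<noteq> 1" by transfer (metis zero_neq_one)
qed

end

lift_definition pRe :: "complex puiseux \<Rightarrow> real puiseux" is "\<lambda>f k. Re (f k)"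
  by (rule wo_support_map) simp_all

lift_definition pIm :: "complex puiseux \<Rightarrow> real puiseux" is "\<lambda>f k. Im (f k)"
  by (rule wo_support_map) simp_all

lift_definition pcomplex_of_real :: "real puiseux \<Rightarrow> complex puiseux"
  is "\<lambda>f k. complex_of_real (f k)"
  by (rule wo_support_map) simp_all

lemma puiseux_Re_Im:
  "pcomplex_of_real (pRe z) + pconst \<i> * pcomplex_of_real (pIm z) = z"
  "pRe (pcomplex_of_real x + pconst \<i> * pcomplex_of_real y) = x"
  "pIm (pcomplex_of_real x + pconst \<i> * pcomplex_of_real y) = y"
  by (rule puiseux_eqI, simp add: pRe.rep_eq pIm.rep_eq pcomplex_of_real.rep_eq
      plus_puiseux.rep_eq pcoeff_pmono_times complex_eq_iff)+

definition leading_exponent :: "'a::zero puiseux \<Rightarrow> real"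
  where "leading_exponent x = (GREATEST k. pcoeff x k \<noteq> 0)"

definition leading_coeff :: "'a::zero puiseux \<Rightarrow> 'a"
  where "leading_coeff x = pcoeff x (leading_exponent x)"

definition valuation :: "'a::comm_ring_1 puiseux \<Rightarrow> ereal"
  where "valuation x = (if x = 0 then - \<infinity> else ereal (leading_exponent x))"

lemma leading_exponent_props:
  fixes x :: "'a::comm_ring_1 puiseux"
  assumes "x \<noteq> 0"
  shows "pcoeff x (leading_exponent x) \<noteq> 0"
    and "\<And>k. pcoeff x k \<noteq> 0 \<Longrightarrow> k \<le> leading_exponent x"
proof -
  obtain k0 where k0: "pcoeff x k0 \<noteq> 0"
    using assms puiseux_eqI[of x 0] by (auto simp: zero_puiseux.rep_eq)
  have ne: "{k. pcoeff x (- k) \<noteq> 0} \<noteq> {}"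
    using k0 by (metis (mono_tags, lifting) empty_iff mem_Collect_eq minus_minus)
  obtain m where m: "m \<in> {k. pcoeff x (- k) \<noteq> 0}" "\<And>b. b \<in> {k. pcoeff x (- k) \<noteq> 0} \<Longrightarrow> m \<le> b"
    using wo_real_minE[OF wo_pcoeff subset_refl ne] by blast
  have max: "k \<le> - m" if "pcoeff x k \<noteq> 0" for k
    using m(2)[of "- k"] that by simp
  then have eq: "leading_exponent x = - m"
    unfolding leading_exponent_def using m(1) by (intro Greatest_equality) auto
  show "pcoeff x (leading_exponent x) \<noteq> 0" using m(1) eq by simp
  show "\<And>k. pcoeff x k \<noteq> 0 \<Longrightarrow> k \<le> leading_exponent x" using max eq by simp
qed

definition puiseux_pos :: "real puiseux \<Rightarrow> bool"
  where "puiseux_pos x \<longleftrightarrow> x \<noteq> 0 \<and> leading_coeff x > 0"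


section \<open>Polynomials with the half-plane property\<close>

text \<open>
  The polynomial ring in \<open>n = CARD('n)\<close> variables is the monoid algebra of \<open>\<nat>\<^sup>n\<close>: a finitely
  supported map from exponent vectors to coefficients.
\<close>

type_synonym ('a, 'n) mpol = "(nat ^ 'n) \<Rightarrow>\<^sub>0 'a"

definition mpol_eval :: "('a::comm_ring_1, 'n::finite) mpol \<Rightarrow> 'a ^ 'n \<Rightarrow> 'a"
  where "mpol_eval P z = (\<Sum>\<alpha>\<in>Poly_Mapping.keys P. Poly_Mapping.lookup P \<alpha> * (\<Prod>j\<in>UNIV. (z $ j) ^ (\<alpha> $ j)))"

definition half_plane :: "real \<Rightarrow> complex puiseux set"
  where "half_plane \<theta> = {z. puiseux_pos (pIm (pconst (exp (\<i> * complex_of_real \<theta>)) * z))}"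

definition half_plane_stable :: "real \<Rightarrow> (complex puiseux, 'n::finite) mpol \<Rightarrow> bool"
  where "half_plane_stable \<theta> P \<longleftrightarrow> (\<forall>z. (\<forall>j. z $ j \<in> half_plane \<theta>) \<longrightarrow> mpol_eval P z \<noteq> 0)"

definition half_plane_property :: "(complex puiseux, 'n::finite) mpol \<Rightarrow> bool"
  where "half_plane_property P \<longleftrightarrow> (\<exists>\<theta>. half_plane_stable \<theta> P)"

text \<open>Supports and tropicalizations live on \<open>\<int>\<^sup>n\<close>, which contains the exponent vectors in \<open>\<nat>\<^sup>n\<close>.\<close>

definition supp :: "('a::zero, 'n::finite) mpol \<Rightarrow> (int ^ 'n) set"
  where "supp P = (\<lambda>\<alpha>. \<chi> i. int (\<alpha> $ i)) ` {\<alpha>. Poly_Mapping.lookup P \<alpha> \<noteq> 0}"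

text \<open>Only the values on \<^term>\<open>supp P\<close> are meaningful; there the valuation is finite.\<close>

definition trop :: "('a::comm_ring_1 puiseux, 'n::finite) mpol \<Rightarrow> int ^ 'n \<Rightarrow> real"
  where "trop P \<alpha> = real_of_ereal (valuation (Poly_Mapping.lookup P (\<chi> i. nat (\<alpha> $ i))))"


section \<open>Steps and M-concave functions\<close>

definition l1 :: "int ^ 'n::finite \<Rightarrow> int"
  where "l1 \<alpha> = (\<Sum>i\<in>UNIV. \<bar>\<alpha> $ i\<bar>)"

definition constant_parity :: "(int ^ 'n::finite) set \<Rightarrow> bool"
  where "constant_parity A \<longleftrightarrow> (\<forall>\<alpha>\<in>A. \<forall>\<beta>\<in>A. even (l1 \<alpha> - l1 \<beta>))"

definition is_step :: "int ^ 'n::finite \<Rightarrow> int ^ 'n \<Rightarrow> int ^ 'n \<Rightarrow> bool"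
  where "is_step \<alpha> s \<beta> \<longleftrightarrow> l1 s = 1 \<and> l1 (\<alpha> + s - \<beta>) = l1 (\<alpha> - \<beta>) - 1"

text \<open>\<^term>\<open>M_concave J f\<close> concerns the restriction of \<^term>\<open>f\<close> to its domain \<^term>\<open>J\<close>.\<close>

definition M_concave :: "(int ^ 'n::finite) set \<Rightarrow> (int ^ 'n \<Rightarrow> real) \<Rightarrow> bool"
  where "M_concave J f \<longleftrightarrow>
    (\<forall>\<alpha>\<in>J. \<forall>\<beta>\<in>J. \<forall>s. is_step \<alpha> s \<beta> \<longrightarrow>
      (\<exists>t. is_step (\<alpha> + s) t \<beta> \<and> \<alpha> + s + t \<in> J \<and> \<beta> - s - t \<in> J \<and>
           f \<alpha> + f \<beta> \<le> f (\<alpha> + s + t) + f (\<beta> - s - t)))"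

end

theory Submission
  imports Defs "HOL-Computational_Algebra.Fundamental_Theorem_Algebra"
begin

text \<open>
  The field \<open>\<complex>{t}\<close> is algebraically closed, so Laguerre's theorem and hence the Grace--Walsh--Szego
  theorem hold over it. Polarizing \<open>P\<close> and replacing some variables \<open>z\<close> by \<open>- 1 / z\<close> reduces the
  claim to a stable multiaffine polynomial \<open>\<Sum>\<^sub>S c(S) z\<^sup>S\<close> supported on even sets, with \<open>\<alpha>\<close> the empty
  set, \<open>\<beta>\<close> a set \<open>B\<close> and the step an element \<open>e \<in> B\<close>; setting the variables outside \<open>B\<close> to zero
  keeps it stable. Substituting a constant \<open>w\<close> for \<open>z\<^sub>e\<close> and \<open>\<lambda>\<^sub>f x\<close> with \<open>\<lambda>\<^sub>f > 0\<close> for the other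
  \<open>z\<^sub>f\<close> gives a stable univariate polynomial \<open>p\<close> of degree \<open>d = |B| - 1\<close>. For suitable \<open>w\<close> the
  leading coefficient of \<open>p\<^sub>0 / p\<^sub>d\<close> is not real, so neither is that of some root, and this forces
  \<open>\<nu>(p\<^sub>0) + \<nu>(p\<^sub>d) \<le> \<nu>(p\<^sub>1) + \<nu>(p\<^sub>d\<^sub>-\<^sub>1)\<close>. Up to factors that cancel, \<open>p\<^sub>0\<close> and \<open>p\<^sub>d\<close> are
  \<open>c({})\<close> and \<open>c(B)\<close>, while \<open>p\<^sub>1\<close> and \<open>p\<^sub>d\<^sub>-\<^sub>1\<close> are \<open>\<Sum>\<^sub>f c({e, f}) \<lambda>\<^sub>f\<close> and
  \<open>\<Sum>\<^sub>f c(B - {e, f}) / \<lambda>\<^sub>f\<close>. If every exchange partner \<open>f\<close> failed, the \<open>\<lambda>\<^sub>f\<close> could be chosen as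
  powers of \<open>t\<close> that violate this inequality.
\<close>


section \<open>Valuation and leading coefficient\<close>

lemmas pcoeff_simps [simp] =
  zero_puiseux.rep_eq plus_puiseux.rep_eq uminus_puiseux.rep_eq pmono.rep_eq
  pRe.rep_eq pIm.rep_eq pcomplex_of_real.rep_eq

lemma pcoeff_diff [simp]: "pcoeff (x - y) k = pcoeff x k - pcoeff y k"
  for x y :: "'a::comm_ring_1 puiseux"
  by (simp add: minus_puiseux_def del: add_uminus_conv_diff)

lemma pcoeff_sum: "pcoeff (sum f I) k = (\<Sum>i\<in>I. pcoeff (f i) k)"
  for f :: "'i \<Rightarrow> 'a::comm_ring_1 puiseux"
  by (induction I rule: infinite_finite_induct) simp_all

lemma valuation_nonzero: "x \<noteq> 0 \<Longrightarrow> valuation x = ereal (leading_exponent x)"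
  by (simp add: valuation_def)

lemma valuation_eq_MInf_iff [simp]: "valuation x = - \<infinity> \<longleftrightarrow> x = 0"
  by (simp add: valuation_def)

lemma valuation_0 [simp]: "valuation 0 = - \<infinity>"
  by simp

lemma valuation_neq_PInf [simp]: "valuation x \<noteq> \<infinity>"
  by (simp add: valuation_def)

lemma valuation_le_iff: "valuation x \<le> ereal k \<longleftrightarrow> (\<forall>j>k. pcoeff x j = 0)"
  for x :: "'a::comm_ring_1 puiseux"
proof (cases "x = 0")
  case False
  then have "leading_exponent x \<le> k \<longleftrightarrow> (\<forall>j>k. pcoeff x j = 0)"
    using leading_exponent_props[OF False] by (meson leD not_le order_trans)
  with False show ?thesis by (simp add: valuation_nonzero)
qed simp

lemma valuation_less_iff: "valuation x < ereal k \<longleftrightarrow> (\<forall>j\<ge>k. pcoeff x j = 0)"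
  for x :: "'a::comm_ring_1 puiseux"
proof (cases "x = 0")
  case False
  then have "leading_exponent x < k \<longleftrightarrow> (\<forall>j\<ge>k. pcoeff x j = 0)"
    using leading_exponent_props[OF False] by (meson leD not_le order_trans)
  with False show ?thesis by (simp add: valuation_nonzero)
qed simp

lemma valuation_eq_iff: "valuation x = ereal k \<longleftrightarrow> valuation x \<le> ereal k \<and> pcoeff x k \<noteq> 0"
  for x :: "'a::comm_ring_1 puiseux"
proof -
  have "valuation x < ereal k \<longleftrightarrow> valuation x \<le> ereal k \<and> pcoeff x k = 0"
    unfolding valuation_le_iff valuation_less_iff by (auto simp: order_le_less)
  then show ?thesis by (auto simp: order_less_le)
qed

lemma leading_coeff_eq_pcoeff: "valuation x = ereal k \<Longrightarrow> leading_coeff x = pcoeff x k"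
  by (auto simp: leading_coeff_def valuation_def split: if_splits)

lemma leading_coeff_eq_0_iff [simp]: "leading_coeff x = 0 \<longleftrightarrow> x = 0"
  for x :: "'a::comm_ring_1 puiseux"
  using leading_exponent_props(1)[of x] by (auto simp: leading_coeff_def)

lemma leading_coeff_0 [simp]: "leading_coeff (0 :: 'a::comm_ring_1 puiseux) = 0"
  by simp

lemma leading_coeff_uminus [simp]: "leading_coeff (- x) = - leading_coeff x"
  for x :: "'a::comm_ring_1 puiseux"
  by (simp add: leading_coeff_def leading_exponent_def)

lemma valuation_uminus [simp]: "valuation (- x) = valuation x"
  for x :: "'a::comm_ring_1 puiseux"
  by (simp add: valuation_def leading_exponent_def)

lemma valuation_add_le:
  fixes x y :: "'a::comm_ring_1 puiseux"
  assumes "valuation x \<le> ereal k" "valuation y \<le> ereal k"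
  shows "valuation (x + y) \<le> ereal k"
  using assms by (simp add: valuation_le_iff)

lemma valuation_sum_less:
  fixes f :: "'i \<Rightarrow> 'a::comm_ring_1 puiseux"
  assumes "\<And>i. i \<in> I \<Longrightarrow> valuation (f i) < ereal k"
  shows "valuation (sum f I) < ereal k"
  using assms by (simp add: valuation_less_iff pcoeff_sum)

lemma
  fixes x y :: "'a::comm_ring_1 puiseux"
  assumes "valuation x \<le> ereal k" "valuation y \<le> ereal l"
  shows valuation_mult_le: "valuation (x * y) \<le> ereal (k + l)"
    and pcoeff_mult_top: "pcoeff (x * y) (k + l) = pcoeff x k * pcoeff y l"
proof -
  have vanish: "pcoeff x i = 0 \<or> pcoeff y (j - i) = 0" if "k < i \<or> l < j - i" for i j
    using assms that by (auto simp: valuation_le_iff)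
  have "pcoeff (x * y) j = (\<Sum>i\<in>{}. pcoeff x i * pcoeff y (j - i))" if "k + l < j" for j
  proof (rule pcoeff_times_superset)
    have "k < i \<or> l < j - i" for i using that by linarith
    then show "{i. pcoeff x i \<noteq> 0 \<and> pcoeff y (j - i) \<noteq> 0} \<subseteq> {}" using vanish by blast
  qed simp
  then show "valuation (x * y) \<le> ereal (k + l)"
    by (simp add: valuation_le_iff)
  have "pcoeff (x * y) (k + l) = (\<Sum>i\<in>{k}. pcoeff x i * pcoeff y (k + l - i))"
  proof (rule pcoeff_times_superset)
    have "k < i \<or> l < k + l - i" if "i \<noteq> k" for i using that by linarith
    then show "{i. pcoeff x i \<noteq> 0 \<and> pcoeff y (k + l - i) \<noteq> 0} \<subseteq> {k}" using vanish by blast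
  qed simp
  then show "pcoeff (x * y) (k + l) = pcoeff x k * pcoeff y l"
    by simp
qed

lemma
  fixes x y :: "'a::idom puiseux"
  shows valuation_mult: "valuation (x * y) = valuation x + valuation y"
    and leading_coeff_mult: "leading_coeff (x * y) = leading_coeff x * leading_coeff y"
proof -
  have "valuation (x * y) = valuation x + valuation y \<and>
      leading_coeff (x * y) = leading_coeff x * leading_coeff y"
  proof (cases "x = 0 \<or> y = 0")
    case False
    then obtain k l where finite_vals: "valuation x = ereal k" "valuation y = ereal l"
      by (auto simp: valuation_nonzero)
    then have "pcoeff x k \<noteq> 0" "pcoeff y l \<noteq> 0"
      by (simp_all add: valuation_eq_iff)
    moreover from finite_vals have top: "pcoeff (x * y) (k + l) = pcoeff x k * pcoeff y l"
      by (simp add: pcoeff_mult_top)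
    ultimately have "valuation (x * y) = ereal (k + l)"
      using finite_vals valuation_mult_le[of x k y l] by (simp add: valuation_eq_iff)
    with finite_vals top show ?thesis
      by (simp add: leading_coeff_eq_pcoeff)
  next
    case True
    then show ?thesis
      using valuation_neq_PInf[of x] valuation_neq_PInf[of y]
      by (cases "valuation x"; cases "valuation y"; elim disjE; simp)
  qed
  then show "valuation (x * y) = valuation x + valuation y"
    "leading_coeff (x * y) = leading_coeff x * leading_coeff y" by auto
qed

instance puiseux :: (idom) idom
proof
  fix x y :: "'a puiseux"
  assume "x \<noteq> 0" "y \<noteq> 0"
  then have "valuation (x * y) \<noteq> - \<infinity>"
    by (simp add: valuation_mult valuation_nonzero)
  then show "x * y \<noteq> 0" by simp
qed

lemma pmono_0 [simp]: "pmono 0 e = (0 :: 'a::comm_ring_1 puiseux)"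
  by (rule puiseux_eqI) simp

lemma pmono_mult: "pmono c e * pmono d f = pmono (c * d) (e + f)" for c d :: "'a::comm_ring_1"
  by (rule puiseux_eqI) (auto simp: pcoeff_pmono_times)

lemma valuation_pmono: "c \<noteq> 0 \<Longrightarrow> valuation (pmono c e) = ereal e"
  for c :: "'a::comm_ring_1"
  by (simp add: valuation_eq_iff valuation_le_iff)

lemma leading_coeff_pmono [simp]: "leading_coeff (pmono c e) = c"
  for c :: "'a::comm_ring_1"
  by (cases "c = 0") (simp_all add: leading_coeff_eq_pcoeff[OF valuation_pmono])

lemma pmono_eq_0_iff [simp]: "pmono c e = 0 \<longleftrightarrow> c = 0" for c :: "'a::comm_ring_1"
  by (metis leading_coeff_pmono leading_coeff_eq_0_iff)

lemma pconst_1: "pconst 1 = (1 :: 'a::comm_ring_1 puiseux)"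
  by (rule puiseux_eqI) (simp add: one_puiseux.rep_eq)

lemma valuation_1 [simp]: "valuation (1 :: 'a::comm_ring_1 puiseux) = 0"
  using valuation_pmono[of "1 :: 'a" 0] by (simp add: pconst_1)

lemma leading_coeff_1 [simp]: "leading_coeff (1 :: 'a::comm_ring_1 puiseux) = 1"
  using leading_coeff_pmono[of "1 :: 'a" 0] by (simp add: pconst_1)

lemma pconst_of_nat: "pconst (of_nat n) = (of_nat n :: 'a::comm_ring_1 puiseux)"
proof (induction n)
  case 0
  then show ?case by (intro puiseux_eqI) simp
next
  case (Suc n)
  have "pconst (of_nat (Suc n)) = pconst 1 + (pconst (of_nat n) :: 'a puiseux)"
    by (rule puiseux_eqI) simp
  with Suc show ?case by (simp add: pconst_1)
qed

lemma leading_coeff_of_nat [simp]: "leading_coeff (of_nat n :: 'a::comm_ring_1 puiseux) = of_nat n"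
  by (simp flip: pconst_of_nat)

lemma valuation_of_nat [simp]:
  "n \<noteq> 0 \<Longrightarrow> valuation (of_nat n :: 'a::{comm_ring_1,ring_char_0} puiseux) = 0"
  by (simp add: valuation_pmono flip: pconst_of_nat)

instance puiseux :: ("{comm_ring_1,ring_char_0}") ring_char_0
proof
  show "inj (of_nat :: nat \<Rightarrow> 'a puiseux)"
    by (rule injI) (metis leading_coeff_of_nat of_nat_eq_iff)
qed

lemma valuation_prod: "valuation (prod f I) = (\<Sum>i\<in>I. valuation (f i))"
  for f :: "'i \<Rightarrow> 'a::idom puiseux"
  by (induction I rule: infinite_finite_induct) (simp_all add: valuation_mult)


section \<open>Algebraic closedness\<close>

text \<open>In other words, \<open>t\<^sup>-\<^sup>V q(t\<^sup>\<rho> x)\<close> has coefficients in the valuation ring, and \<open>g\<close> is its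
  reduction.\<close>

definition initial_form :: "real \<Rightarrow> real \<Rightarrow> 'a::comm_ring_1 puiseux poly \<Rightarrow> 'a poly \<Rightarrow> bool"
  where "initial_form \<rho> V q g \<longleftrightarrow> (\<forall>i. valuation (coeff q i) \<le> ereal (V - real i * \<rho>) \<and>
    coeff g i = pcoeff (coeff q i) (V - real i * \<rho>))"

lemma initial_form_0: "initial_form \<rho> V 0 g \<longleftrightarrow> g = 0"
  by (simp add: initial_form_def poly_eq_iff)

lemma initial_form_pCons:
  "initial_form \<rho> V (pCons a q) (pCons b g) \<longleftrightarrow>
    valuation a \<le> ereal V \<and> b = pcoeff a V \<and> initial_form \<rho> (V - \<rho>) q g"
  (is "?lhs \<longleftrightarrow> ?rhs")
proof
  assume ?lhs
  from this[unfolded initial_form_def, rule_format, of 0]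
  have "valuation a \<le> ereal V \<and> b = pcoeff a V" by simp
  moreover from \<open>?lhs\<close>[unfolded initial_form_def, rule_format, of "Suc i" for i]
  have "initial_form \<rho> (V - \<rho>) q g"
    by (simp add: initial_form_def algebra_simps)
  ultimately show ?rhs by blast
next
  assume ?rhs
  show ?lhs
    unfolding initial_form_def
  proof
    fix i
    show "valuation (coeff (pCons a q) i) \<le> ereal (V - real i * \<rho>) \<and>
        coeff (pCons b g) i = pcoeff (coeff (pCons a q) i) (V - real i * \<rho>)"
      using \<open>?rhs\<close> by (cases i) (simp_all add: initial_form_def algebra_simps)
  qed
qed

lemma initial_form_add:
  "initial_form \<rho> V q g \<Longrightarrow> initial_form \<rho> V q' g' \<Longrightarrow> initial_form \<rho> V (q + q') (g + g')"
  by (simp add: initial_form_def valuation_add_le)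

lemma initial_form_smult:
  assumes "valuation h \<le> ereal \<sigma>" "initial_form \<rho> V q g"
  shows "initial_form \<rho> (\<sigma> + V) (smult h q) (smult (pcoeff h \<sigma>) g)"
  using assms unfolding initial_form_def
  by (simp add: add_diff_eq[symmetric] valuation_mult_le pcoeff_mult_top)

lemma initial_form_shift:
  assumes "initial_form \<rho> V q g" and h: "valuation h \<le> ereal \<rho>"
  shows "initial_form \<rho> V (q \<circ>\<^sub>p [:h, 1:]) (g \<circ>\<^sub>p [:pcoeff h \<rho>, 1:])"
  using assms(1)
proof (induction q arbitrary: V g)
  case 0
  then show ?case by (simp add: initial_form_0)
next
  case (pCons a q)
  obtain b g' where g: "g = pCons b g'" by (cases g)
  with pCons.prems have a: "valuation a \<le> ereal V" "b = pcoeff a V"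
    and "initial_form \<rho> (V - \<rho>) q g'"
    by (simp_all add: initial_form_pCons)
  let ?q = "q \<circ>\<^sub>p [:h, 1:]" and ?g = "g' \<circ>\<^sub>p [:pcoeff h \<rho>, 1:]"
  have IH: "initial_form \<rho> (V - \<rho>) ?q ?g" by (rule pCons.IH) fact
  have "initial_form \<rho> V [:a:] [:b:]"
    using a by (simp add: initial_form_pCons initial_form_0)
  moreover have "initial_form \<rho> V (smult h ?q) (smult (pcoeff h \<rho>) ?g)"
    using initial_form_smult[OF h IH] by simp
  moreover have "initial_form \<rho> V (pCons 0 ?q) (pCons 0 ?g)"
    using IH by (simp add: initial_form_pCons)
  ultimately show ?case
    by (simp add: g pcompose_pCons initial_form_add)
qed

text \<open>The valuation of the smallest roots of \<open>q\<close>, read off the Newton polygon.\<close>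

definition newton_slope :: "'a::comm_ring_1 puiseux poly \<Rightarrow> real"
  where "newton_slope q =
    Min ((\<lambda>i. (leading_exponent (coeff q 0) - leading_exponent (coeff q i)) / real i) ` {i. 0 < i \<and> coeff q i \<noteq> 0})"

lemma finite_nonzero_coeffs: "finite {i. 0 < i \<and> coeff q i \<noteq> 0}"
  by (rule finite_subset[of _ "{..degree q}"]) (auto intro: le_degree)

lemma newton_slope_le:
  "0 < i \<Longrightarrow> coeff q i \<noteq> 0 \<Longrightarrow>
    newton_slope q \<le> (leading_exponent (coeff q 0) - leading_exponent (coeff q i)) / real i"
  unfolding newton_slope_def by (intro Min_le finite_imageI finite_nonzero_coeffs) auto

lemma newton_slope_attained:
  assumes "degree q > 0"
  obtains i where "0 < i" "coeff q i \<noteq> 0"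
    "newton_slope q = (leading_exponent (coeff q 0) - leading_exponent (coeff q i)) / real i"
proof -
  have "degree q \<in> {i. 0 < i \<and> coeff q i \<noteq> 0}" using assms by auto
  then have "newton_slope q \<in>
      (\<lambda>i. (leading_exponent (coeff q 0) - leading_exponent (coeff q i)) / real i) ` {i. 0 < i \<and> coeff q i \<noteq> 0}"
    unfolding newton_slope_def by (intro Min_in finite_imageI finite_nonzero_coeffs) auto
  with that show thesis by auto
qed

lemma initial_form_newton_slope:
  assumes q0: "coeff q 0 \<noteq> 0" and deg: "degree q > 0"
  obtains g where "initial_form (newton_slope q) (leading_exponent (coeff q 0)) q g"
    "0 < degree g" "degree g \<le> degree q"
proof -
  define \<rho> V where "\<rho> = newton_slope q" and "V = leading_exponent (coeff q 0)"
  define g where "g = (\<Sum>i\<le>degree q. monom (pcoeff (coeff q i) (V - real i * \<rho>)) i)"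
  have coeff_g: "coeff g i = pcoeff (coeff q i) (V - real i * \<rho>)" for i
    by (auto simp: g_def coeff_sum coeff_eq_0)
  have "valuation (coeff q i) \<le> ereal (V - real i * \<rho>)" for i
  proof (cases "coeff q i = 0 \<or> i = 0")
    case True
    then show ?thesis using q0 by (auto simp: V_def valuation_nonzero)
  next
    case False
    then have "\<rho> * real i \<le> V - leading_exponent (coeff q i)"
      using newton_slope_le[of i q] by (simp add: \<rho>_def V_def pos_le_divide_eq)
    with False show ?thesis by (simp add: valuation_nonzero algebra_simps)
  qed
  then have "initial_form \<rho> V q g" by (simp add: initial_form_def coeff_g)
  moreover obtain i where i: "0 < i" "coeff q i \<noteq> 0"
    "\<rho> = (V - leading_exponent (coeff q i)) / real i"
    using newton_slope_attained[OF deg] unfolding \<rho>_def V_def by blast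
  then have "V - real i * \<rho> = leading_exponent (coeff q i)" by (simp add: field_simps)
  then have "coeff g i \<noteq> 0" using i(2) by (simp add: coeff_g leading_exponent_props)
  then have "0 < degree g" using i(1) by (meson le_degree less_le_trans)
  moreover have "degree g \<le> degree q" by (rule degree_le) (simp add: coeff_g coeff_eq_0)
  ultimately show thesis using that by (simp add: \<rho>_def V_def)
qed

lemma
  fixes q :: "'a::idom puiseux poly"
  assumes init: "initial_form \<rho> V q g" "0 < degree g" and h: "valuation h \<le> ereal \<rho>"
    and nz: "coeff (q \<circ>\<^sub>p [:h, 1:]) 0 \<noteq> 0"
  shows newton_slope_shift_le: "newton_slope (q \<circ>\<^sub>p [:h, 1:]) \<le> \<rho>"
    and newton_slope_shift_less: "poly g (pcoeff h \<rho>) = 0 \<Longrightarrow> newton_slope (q \<circ>\<^sub>p [:h, 1:]) < \<rho>"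
proof -
  define q' g' where "q' = q \<circ>\<^sub>p [:h, 1:]" and "g' = g \<circ>\<^sub>p [:pcoeff h \<rho>, 1:]"
  let ?\<nu> = "leading_exponent (coeff q' 0)"
  have q'0: "coeff q' 0 \<noteq> 0" using nz by (simp add: q'_def)
  have init': "valuation (coeff q' i) \<le> ereal (V - real i * \<rho>)"
    "coeff g' i = pcoeff (coeff q' i) (V - real i * \<rho>)" for i
    using initial_form_shift[OF init(1) h] unfolding initial_form_def q'_def g'_def by blast+
  define i where "i = degree g'"
  have i: "0 < i" using init(2) by (simp add: i_def g'_def degree_pcompose)
  then have "coeff g' i \<noteq> 0" by (auto simp: i_def)
  with init' have "valuation (coeff q' i) = ereal (V - real i * \<rho>)"
    by (simp add: valuation_eq_iff)
  then have "coeff q' i \<noteq> 0" "leading_exponent (coeff q' i) = V - real i * \<rho>"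
    by (auto simp: valuation_def split: if_splits)
  then have slope: "newton_slope q' \<le> (?\<nu> - V) / real i + \<rho>"
    using newton_slope_le[OF i, of q'] i by (simp add: field_simps)
  have "?\<nu> \<le> V" using init'(1)[of 0] q'0 by (simp add: valuation_nonzero)
  then have "(?\<nu> - V) / real i \<le> 0" using i by (simp add: divide_nonpos_pos)
  with slope show "newton_slope (q \<circ>\<^sub>p [:h, 1:]) \<le> \<rho>" unfolding q'_def by linarith
  assume "poly g (pcoeff h \<rho>) = 0"
  then have "pcoeff (coeff q' 0) V = 0" using init'(2)[of 0] by (simp add: g'_def)
  then have "?\<nu> \<noteq> V" using leading_exponent_props(1)[OF q'0] by auto
  with \<open>?\<nu> \<le> V\<close> have "(?\<nu> - V) / real i < 0" using i by (simp add: divide_neg_pos)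
  with slope show "newton_slope (q \<circ>\<^sub>p [:h, 1:]) < \<rho>" unfolding q'_def by linarith
qed

lemma nested_balls_inhabited:
  fixes C :: "'a::comm_ring_1 puiseux set" and \<rho> :: "'a puiseux \<Rightarrow> real"
  assumes nested: "\<And>a b. a \<in> C \<Longrightarrow> b \<in> C \<Longrightarrow> valuation (b - a) \<le> ereal (max (\<rho> a) (\<rho> b))"
  obtains x where "\<And>a. a \<in> C \<Longrightarrow> valuation (x - a) \<le> ereal (\<rho> a)"
proof -
  define f where "f k = (if \<exists>a\<in>C. \<rho> a < k then pcoeff (SOME a. a \<in> C \<and> \<rho> a < k) k else 0)" for k
  have f_eq: "f k = pcoeff a k" if a: "a \<in> C" "\<rho> a < k" for a k
  proof -
    define b where "b = (SOME a. a \<in> C \<and> \<rho> a < k)"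
    have b: "b \<in> C \<and> \<rho> b < k" unfolding b_def by (rule someI[of _ a]) (use a in simp)
    then have "pcoeff (b - a) k = 0"
      using nested[of a b] a unfolding valuation_le_iff by simp
    with a show ?thesis by (auto simp: f_def b_def)
  qed
  have "wfp_on {k. f (- k) \<noteq> 0} (<)"
    unfolding wo_real_iff_min
  proof (intro allI impI)
    fix B assume B: "B \<subseteq> {k. f (- k) \<noteq> 0}" "B \<noteq> {}"
    then obtain b where b: "b \<in> B" "f (- b) \<noteq> 0" by blast
    then obtain a where a: "a \<in> C" "\<rho> a < - b" by (auto simp: f_def split: if_splits)
    have "f (- k) = pcoeff a (- k)" if "k \<le> b" for k
      using a that by (intro f_eq) auto
    then have "{k \<in> B. k \<le> b} \<subseteq> {k. pcoeff a (- k) \<noteq> 0}" using B(1) by auto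
    moreover have "{k \<in> B. k \<le> b} \<noteq> {}" using b by blast
    ultimately obtain m where "m \<in> {k \<in> B. k \<le> b}" "\<And>k. k \<in> {k \<in> B. k \<le> b} \<Longrightarrow> m \<le> k"
      using wo_real_minE[OF wo_pcoeff[of a], of "{k \<in> B. k \<le> b}"] by metis
    then show "\<exists>m\<in>B. \<forall>b\<in>B. m \<le> b"
      by (metis (mono_tags, lifting) mem_Collect_eq linear order_trans)
  qed
  then have coeff: "pcoeff (Abs_puiseux f) = f" by (intro Abs_puiseux_inverse) simp
  show thesis
  proof (rule that[of "Abs_puiseux f"])
    fix a assume "a \<in> C"
    then show "valuation (Abs_puiseux f - a) \<le> ereal (\<rho> a)"
      by (simp add: valuation_le_iff coeff f_eq)
  qed
qed

text \<open>A maximal chain of nested balls of decreasing radii has a common point, which cannot be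
  improved.\<close>

lemma minimal_radius_exists:
  fixes \<rho> :: "'a::comm_ring_1 puiseux \<Rightarrow> real"
  assumes mono: "\<And>a b. valuation (b - a) \<le> ereal (\<rho> a) \<Longrightarrow> \<rho> b \<le> \<rho> a"
  shows "\<exists>a. \<forall>b. valuation (b - a) \<le> ereal (\<rho> a) \<longrightarrow> \<rho> a \<le> \<rho> b"
proof (rule ccontr)
  define improves where "improves a b \<longleftrightarrow> valuation (b - a) \<le> ereal (\<rho> a) \<and> \<rho> b < \<rho> a" for a b
  obtain C where C: "pred_on.maxchain UNIV improves C" using pred_on.Hausdorff by blast
  then have chain: "improves a b \<or> improves b a \<or> a = b" if "a \<in> C" "b \<in> C" for a b
    using that unfolding pred_on.maxchain_def pred_on.chain_def by blast
  have "valuation (b - a) \<le> ereal (max (\<rho> a) (\<rho> b))" if ab: "a \<in> C" "b \<in> C" for a b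
  proof -
    have "valuation (b - a) = valuation (a - b)" using valuation_uminus[of "a - b"] by simp
    then show ?thesis using chain[OF ab] by (auto simp: improves_def max_def)
  qed
  then obtain x where x: "\<And>a. a \<in> C \<Longrightarrow> valuation (x - a) \<le> ereal (\<rho> a)"
    using nested_balls_inhabited[of C \<rho>] by blast
  assume "\<nexists>a. \<forall>b. valuation (b - a) \<le> ereal (\<rho> a) \<longrightarrow> \<rho> a \<le> \<rho> b"
  then obtain b where b: "valuation (b - x) \<le> ereal (\<rho> x)" "\<rho> b < \<rho> x" by (meson not_le)
  have above: "improves a b" if "a \<in> C" for a
  proof -
    have "\<rho> x \<le> \<rho> a" by (rule mono[OF x[OF that]])
    with b have "valuation (b - x) \<le> ereal (\<rho> a)" "\<rho> b < \<rho> a"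
      by (auto intro: order_trans)
    with valuation_add_le[OF this(1) x[OF that]] show ?thesis by (simp add: improves_def)
  qed
  then have "b \<notin> C" by (auto simp: improves_def)
  moreover have "pred_on.chain UNIV improves (insert b C)"
    unfolding pred_on.chain_def using chain above by blast
  ultimately show False
    using C unfolding pred_on.maxchain_def by blast
qed

text \<open>Newton's step from \<open>a\<close>, along a root of the initial form of \<open>p(a + x)\<close>, decreases the valuation
  of the distance to the nearest root.\<close>

theorem puiseux_poly_has_root:
  fixes p :: "'a::idom puiseux poly"
  assumes deg: "degree p > 0"
    and residue_root: "\<And>g :: 'a poly. 0 < degree g \<Longrightarrow> degree g \<le> degree p \<Longrightarrow> \<exists>c. poly g c = 0"
  shows "\<exists>z. poly p z = 0"
proof (rule ccontr)
  assume no_root: "\<nexists>z. poly p z = 0"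
  define q where "q a = p \<circ>\<^sub>p [:a, 1:]" for a
  have q0: "coeff (q a) 0 \<noteq> 0" and deg_q: "degree (q a) = degree p" for a
    using no_root by (simp_all add: q_def degree_pcompose)
  have q_shift: "q a \<circ>\<^sub>p [:b - a, 1:] = q b" for a b
    by (simp add: q_def pcompose_assoc[symmetric] pcompose_pCons)
  define \<rho> where "\<rho> a = newton_slope (q a)" for a
  have init: "\<exists>g. initial_form (\<rho> a) (leading_exponent (coeff (q a) 0)) (q a) g \<and>
      0 < degree g \<and> degree g \<le> degree p" for a
    using initial_form_newton_slope[OF q0, of a] deg by (metis \<rho>_def deg_q)
  have "\<rho> b \<le> \<rho> a" if "valuation (b - a) \<le> ereal (\<rho> a)" for a b
    using init[of a] newton_slope_shift_le[OF _ _ that] q0 q_shift by (metis \<rho>_def)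
  then obtain a where minimal: "\<And>b. valuation (b - a) \<le> ereal (\<rho> a) \<Longrightarrow> \<rho> a \<le> \<rho> b"
    using minimal_radius_exists by blast
  obtain g where g: "initial_form (\<rho> a) (leading_exponent (coeff (q a) 0)) (q a) g" "0 < degree g"
    "degree g \<le> degree p" using init by blast
  then obtain c where c: "poly g c = 0" using residue_root by blast
  define b where "b = a + pmono c (\<rho> a)"
  have b: "valuation (b - a) \<le> ereal (\<rho> a)" "pcoeff (b - a) (\<rho> a) = c"
    by (simp_all add: b_def valuation_le_iff)
  then have "\<rho> b < \<rho> a"
    using newton_slope_shift_less[OF g(1,2) b(1)] c q0 by (simp add: \<rho>_def q_shift)
  with minimal[OF b(1)] show False by simp
qed

instantiation puiseux :: (field) field
begin

definition inverse_puiseux :: "'a puiseux \<Rightarrow> 'a puiseux"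
  where "inverse_puiseux x = (if x = 0 then 0 else SOME y. x * y = 1)"

definition divide_puiseux :: "'a puiseux \<Rightarrow> 'a puiseux \<Rightarrow> 'a puiseux"
  where "divide_puiseux x y = x * inverse y"

instance
proof
  fix x y :: "'a puiseux"
  show "x div y = x * inverse y" by (rule divide_puiseux_def)
  show "inverse (0 :: 'a puiseux) = 0" by (simp add: inverse_puiseux_def)
  assume x: "x \<noteq> 0"
  have "\<exists>c. poly g c = 0" if "0 < degree g" "degree g \<le> degree [:- 1, x:]" for g :: "'a poly"
  proof -
    have "degree g = 1" using that x by simp
    then obtain a b where "g = [:b, a:]" "a \<noteq> 0" by (rule degree1_coeffs)
    then have "poly g (- b / a) = 0" by simp
    then show ?thesis ..
  qed
  then have "\<exists>y. poly [:- 1, x:] y = 0" using x by (intro puiseux_poly_has_root) auto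
  then have "\<exists>y. x * y = 1" by (simp add: mult.commute eq_neg_iff_add_eq_0[symmetric])
  then have "x * (SOME y. x * y = 1) = 1" by (rule someI_ex)
  with x show "inverse x * x = 1" by (simp add: inverse_puiseux_def mult.commute)
qed

end

instance puiseux :: (alg_closed_field) alg_closed_field
  by (intro alg_closedI puiseux_poly_has_root alg_closed_imp_poly_has_root)

instance puiseux :: (field_char_0) field_char_0 ..

lemma valuation_inverse: "x \<noteq> 0 \<Longrightarrow> valuation (inverse x) = - valuation x"
  for x :: "'a::field puiseux"
proof -
  assume "x \<noteq> 0"
  then have "valuation x + valuation (inverse x) = 0"
    by (simp flip: valuation_mult)
  then show ?thesis
    by (cases "valuation x"; cases "valuation (inverse x)") simp_all
qed

lemma valuation_divide: "y \<noteq> 0 \<Longrightarrow> valuation (x / y) = valuation x - valuation y"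
  for x y :: "'a::field puiseux"
  by (simp add: divide_inverse valuation_mult valuation_inverse minus_ereal_def)

lemma leading_coeff_divide: "leading_coeff (x / y) = leading_coeff x / leading_coeff y"
  for x y :: "'a::field puiseux"
proof (cases "y = 0")
  case False
  then have "leading_coeff (x / y) * leading_coeff y = leading_coeff x"
    by (simp flip: leading_coeff_mult)
  with False show ?thesis by (simp add: eq_divide_eq)
qed simp


section \<open>The ordered field and its complexification\<close>

lemma
  fixes x y :: "'a::linordered_idom puiseux"
  assumes x: "0 < leading_coeff x" and y: "0 < leading_coeff y"
  shows leading_coeff_add_pos: "0 < leading_coeff (x + y)"
    and valuation_le_add_pos: "valuation x \<le> valuation (x + y)"
proof -
  have dominated: "valuation (x + y) = valuation y \<and> 0 < leading_coeff (x + y)"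
    if x: "0 < leading_coeff x" and y: "0 < leading_coeff y" and order: "valuation x \<le> valuation y"
    for x y :: "'a puiseux"
  proof -
    obtain k where k: "valuation y = ereal k"
      using y by (cases "valuation y") auto
    have "0 \<le> pcoeff x k"
      using x order k by (cases "valuation x = ereal k")
        (auto simp: leading_coeff_eq_pcoeff valuation_less_iff order_le_less)
    then have "0 < pcoeff (x + y) k"
      using y k by (simp add: leading_coeff_eq_pcoeff)
    moreover from this have "valuation (x + y) = ereal k"
      using order k by (simp add: valuation_eq_iff[of "x + y"] valuation_add_le)
    ultimately show ?thesis using k by (simp add: leading_coeff_eq_pcoeff)
  qed
  show "0 < leading_coeff (x + y)" "valuation x \<le> valuation (x + y)"
    using dominated[of x y] dominated[of y x] x y
    by (cases "valuation x \<le> valuation y"; simp add: add.commute)+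
qed

instantiation puiseux :: (linordered_idom) linordered_idom
begin

definition less_puiseux :: "'a puiseux \<Rightarrow> 'a puiseux \<Rightarrow> bool"
  where "less_puiseux x y \<longleftrightarrow> 0 < leading_coeff (y - x)"

definition less_eq_puiseux :: "'a puiseux \<Rightarrow> 'a puiseux \<Rightarrow> bool"
  where "less_eq_puiseux x y \<longleftrightarrow> x = y \<or> x < y"

definition abs_puiseux :: "'a puiseux \<Rightarrow> 'a puiseux"
  where "abs_puiseux x = (if x < 0 then - x else x)"

definition sgn_puiseux :: "'a puiseux \<Rightarrow> 'a puiseux"
  where "sgn_puiseux x = (if x = 0 then 0 else if 0 < x then 1 else - 1)"

instance
proof
  fix x y z :: "'a puiseux"
  have less_trans: "x < z" if "x < y" "y < z" for x y z :: "'a puiseux"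
    using leading_coeff_add_pos[of "z - y" "y - x"] that by (simp add: less_puiseux_def)
  have asym: "\<not> y < x" if "x < y" for x y :: "'a puiseux"
    using that leading_coeff_uminus[of "x - y"] by (simp add: less_puiseux_def)
  show "x < y \<longleftrightarrow> x \<le> y \<and> \<not> y \<le> x"
    using asym[of x y] by (auto simp: less_eq_puiseux_def less_puiseux_def)
  show "x \<le> x" by (simp add: less_eq_puiseux_def)
  show "x \<le> y \<Longrightarrow> y \<le> z \<Longrightarrow> x \<le> z"
    using less_trans[of x y z] by (auto simp: less_eq_puiseux_def)
  show "x \<le> y \<Longrightarrow> y \<le> x \<Longrightarrow> x = y"
    using asym[of x y] by (auto simp: less_eq_puiseux_def)
  show "x \<le> y \<or> y \<le> x"
    using leading_coeff_uminus[of "x - y"] leading_coeff_eq_0_iff[of "x - y"]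
    by (auto simp: less_eq_puiseux_def less_puiseux_def simp del: leading_coeff_eq_0_iff)
  show "x \<le> y \<Longrightarrow> z + x \<le> z + y"
    by (auto simp: less_eq_puiseux_def less_puiseux_def)
  show "x < y \<Longrightarrow> 0 < z \<Longrightarrow> z * x < z * y"
    by (simp add: less_puiseux_def leading_coeff_mult flip: right_diff_distrib)
  show "\<bar>x\<bar> = (if x < 0 then - x else x)" by (rule abs_puiseux_def)
  show "sgn x = (if x = 0 then 0 else if 0 < x then 1 else - 1)" by (rule sgn_puiseux_def)
qed

end

instance puiseux :: (linordered_field) linordered_field ..

lemma puiseux_pos_iff: "puiseux_pos x \<longleftrightarrow> 0 < x"
  by (auto simp: puiseux_pos_def less_puiseux_def)

lemma valuation_mono: "0 \<le> x \<Longrightarrow> x \<le> y \<Longrightarrow> valuation x \<le> valuation y"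
  for x y :: "'a::linordered_idom puiseux"
  using valuation_le_add_pos[of x "y - x"]
  by (cases "x = 0 \<or> x = y") (auto simp: less_eq_puiseux_def less_puiseux_def)

lemma pRe_simps [simp]:
  "pRe 0 = 0" "pRe 1 = 1" "pRe (x + y) = pRe x + pRe y" "pRe (- x) = - pRe x"
  "pRe (x - y) = pRe x - pRe y" "pRe (pmono c e) = pmono (Re c) e" "pRe (of_nat n) = of_nat n"
  "pRe (pcomplex_of_real r) = r"
  by (rule puiseux_eqI, simp add: one_puiseux.rep_eq flip: pconst_of_nat)+

lemma pIm_simps [simp]:
  "pIm 0 = 0" "pIm 1 = 0" "pIm (x + y) = pIm x + pIm y" "pIm (- x) = - pIm x"
  "pIm (x - y) = pIm x - pIm y" "pIm (pmono c e) = pmono (Im c) e" "pIm (of_nat n) = 0"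
  "pIm (pcomplex_of_real r) = 0"
  by (rule puiseux_eqI, simp add: one_puiseux.rep_eq flip: pconst_of_nat)+

lemma pcomplex_of_real_simps:
  "pcomplex_of_real (x + y) = pcomplex_of_real x + pcomplex_of_real y"
  "pcomplex_of_real (x - y) = pcomplex_of_real x - pcomplex_of_real y"
  "pcomplex_of_real (x * y) = pcomplex_of_real x * pcomplex_of_real y"
  by (rule puiseux_eqI, simp add: times_puiseux.rep_eq)+

lemma
  shows pRe_mult: "pRe (x * y) = pRe x * pRe y - pIm x * pIm y"
    and pIm_mult: "pIm (x * y) = pRe x * pIm y + pIm x * pRe y"
proof -
  let ?i = "pconst \<i> :: complex puiseux"
  have i: "?i * ?i = - 1"
    by (rule puiseux_eqI) (simp add: pcoeff_pmono_times one_puiseux.rep_eq)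
  have "x * y = (pcomplex_of_real (pRe x) + ?i * pcomplex_of_real (pIm x)) *
      (pcomplex_of_real (pRe y) + ?i * pcomplex_of_real (pIm y))"
    by (simp only: puiseux_Re_Im)
  also have "\<dots> = pcomplex_of_real (pRe x * pRe y - pIm x * pIm y) +
      ?i * pcomplex_of_real (pRe x * pIm y + pIm x * pRe y)"
    unfolding pcomplex_of_real_simps using i by algebra
  finally have xy: "x * y = \<dots>" .
  show "pRe (x * y) = pRe x * pRe y - pIm x * pIm y"
    "pIm (x * y) = pRe x * pIm y + pIm x * pRe y"
    unfolding xy by (rule puiseux_Re_Im)+
qed

lemma pIm_sum_mset: "pIm (\<Sum>x\<in>#A. f x) = (\<Sum>x\<in>#A. pIm (f x))"
  by (induction A) simp_all

definition pnorm2 :: "complex puiseux \<Rightarrow> real puiseux"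
  where "pnorm2 z = (pRe z)\<^sup>2 + (pIm z)\<^sup>2"

lemma pnorm2_pos: "z \<noteq> 0 \<Longrightarrow> 0 < pnorm2 z"
  using puiseux_Re_Im(1)[of z] puiseux_Re_Im(1)[of 0]
  by (auto simp: pnorm2_def sum_power2_gt_zero_iff)

lemma
  assumes "z \<noteq> 0"
  shows pIm_inverse: "pIm (inverse z) = - pIm z / pnorm2 z"
    and pnorm2_inverse: "pnorm2 (inverse z) = 1 / pnorm2 z"
proof -
  have "z * inverse z = 1" using assms by simp
  from arg_cong[OF this, of pRe] arg_cong[OF this, of pIm]
  have re: "pRe z * pRe (inverse z) - pIm z * pIm (inverse z) = 1"
    and im: "pRe z * pIm (inverse z) + pIm z * pRe (inverse z) = 0"
    by (simp_all add: pRe_mult pIm_mult)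
  have "pIm (inverse z) * pnorm2 z = - pIm z" "pnorm2 (inverse z) * pnorm2 z = 1"
    unfolding pnorm2_def using re im by algebra+
  moreover have "pnorm2 z \<noteq> 0" using pnorm2_pos[OF assms] by simp
  ultimately show "pIm (inverse z) = - pIm z / pnorm2 z" "pnorm2 (inverse z) = 1 / pnorm2 z"
    by (metis nonzero_eq_divide_eq)+
qed

lemma pIm_inverse_sign:
  assumes "z \<noteq> 0"
  shows "0 < pIm (inverse z) \<longleftrightarrow> pIm z < 0" "0 \<le> pIm (inverse z) \<longleftrightarrow> pIm z \<le> 0"
  using pnorm2_pos[OF assms]
  by (auto simp: pIm_inverse[OF assms] divide_less_0_iff divide_le_0_iff dest: less_asym)

lemma pmono_pos_iff [simp]: "0 < pmono c e \<longleftrightarrow> 0 < c" for c :: "'a::linordered_idom"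
  by (simp add: less_puiseux_def)


lemma valuation_pIm_le: "valuation (pIm z) \<le> valuation z"
proof (cases "valuation z")
  case (real k)
  then have "valuation z \<le> ereal k" by simp
  then have "valuation (pIm z) \<le> ereal k" unfolding valuation_le_iff by simp
  with real show ?thesis by simp
qed auto

lemma valuation_pIm_eq: "Im (leading_coeff z) \<noteq> 0 \<Longrightarrow> valuation (pIm z) = valuation z"
proof -
  assume nonreal: "Im (leading_coeff z) \<noteq> 0"
  then obtain k where k: "valuation z = ereal k" by (cases "valuation z") auto
  with nonreal have "Im (pcoeff z k) \<noteq> 0" by (simp add: leading_coeff_eq_pcoeff)
  with k valuation_pIm_le[of z] show ?thesis by (simp add: valuation_eq_iff[of "pIm z"])
qed


section \<open>Stable polynomials in one variable\<close>

definition stable_poly :: "complex puiseux poly \<Rightarrow> bool"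
  where "stable_poly p \<longleftrightarrow> (\<forall>z. 0 < pIm z \<longrightarrow> poly p z \<noteq> 0)"

lemma stable_poly_factorization:
  assumes "stable_poly p"
  obtains R where "size R = degree p" "p = smult (lead_coeff p) (\<Prod>r\<in>#R. [:- r, 1:])"
    "lead_coeff p \<noteq> 0" "\<And>r. r \<in># R \<Longrightarrow> pIm r \<le> 0"
proof -
  have "poly p (pconst \<i>) \<noteq> 0" using assms by (simp add: stable_poly_def)
  then have "p \<noteq> 0" by auto
  then obtain R where R: "size R = degree p" "p = smult (lead_coeff p) (\<Prod>r\<in>#R. [:- r, 1:])"
    using alg_closed_imp_factorization by blast
  have "pIm r \<le> 0" if "r \<in># R" for r
  proof -
    from that have "poly (\<Prod>r\<in>#R. [:- r, 1:]) r = 0" by (auto simp: poly_prod_mset)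
    then have "poly p r = 0" by (subst R(2)) simp
    with assms show ?thesis by (auto simp: stable_poly_def not_less[symmetric])
  qed
  with R \<open>p \<noteq> 0\<close> show thesis by (intro that[of R]) auto
qed

lemma poly_pderiv_prod_linear:
  fixes z :: "'a::field"
  assumes "z \<notin># R"
  shows "poly (pderiv (smult l (\<Prod>r\<in>#R. [:- r, 1:]))) z =
    poly (smult l (\<Prod>r\<in>#R. [:- r, 1:])) z * (\<Sum>r\<in>#R. inverse (z - r))"
  using assms
proof (induction R)
  case (add r R)
  let ?P = "smult l (\<Prod>r\<in>#R. [:- r, 1:])" and ?S = "\<Sum>r\<in>#R. inverse (z - r)"
  from add have "z - r \<noteq> 0" "poly (pderiv ?P) z = poly ?P z * ?S" by auto
  then have "poly (pderiv ([:- r, 1:] * ?P)) z = (z - r) * poly ?P z * (inverse (z - r) + ?S)"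
    by (simp add: pderiv_mult pderiv_pCons distrib_left del: mult_pCons_left mult_smult_right)
  then show ?case by (simp del: mult_pCons_left)
qed (simp add: pderiv_smult)

lemma pnorm2_pIm_inverse:
  "v \<noteq> 0 \<Longrightarrow> y * pnorm2 (inverse v) + pIm (inverse v) = (y - pIm v) / pnorm2 v"
  by (simp add: pIm_inverse pnorm2_inverse diff_divide_distrib)

text \<open>For \<open>y > 0\<close> the condition \<open>y * pnorm2 u + pIm u \<le> 0\<close> describes a closed disc, namely \<open>0\<close> and the
  reciprocals of the points with imaginary part at least \<open>y\<close>. The bound is the half-plane that
  contains this disc and is orthogonal to the line from its centre to \<open>q\<close>.\<close>

lemma disc_half_plane:
  assumes "0 < y" "y * pnorm2 u + pIm u \<le> 0"
  shows "2 * y * (pRe q * pRe u + pIm q * pIm u) + pIm u \<le> y * pnorm2 q"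
proof -
  have "2 * y * (pRe q * pRe u + pIm q * pIm u) + pIm u =
      y * pnorm2 q + (y * pnorm2 u + pIm u) - y * pnorm2 (u - q)"
    by (simp add: pnorm2_def power2_eq_square algebra_simps)
  moreover have "0 \<le> y * pnorm2 (u - q)"
    using assms(1) by (simp add: pnorm2_def)
  ultimately show ?thesis using assms(2) by linarith
qed

lemma disc_mean:
  assumes y: "0 < y" and disc: "\<And>u. u \<in># U \<Longrightarrow> y * pnorm2 u + pIm u \<le> 0"
    and mean: "\<Sum>\<^sub># U = of_nat k * q" and k: "size U \<le> k" "0 < k"
  shows "y * pnorm2 q + pIm q \<le> 0"
proof -
  define l where "l u = 2 * y * (pRe q * pRe u + pIm q * pIm u) + pIm u" for u
  have "l (\<Sum>\<^sub># U) = (\<Sum>u\<in>#U. l u)"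
    by (induction U) (simp_all add: l_def algebra_simps)
  also have "\<dots> \<le> (\<Sum>u\<in>#U. y * pnorm2 q)"
    unfolding l_def by (rule sum_mset_mono) (rule disc_half_plane[OF y disc])
  also have "\<dots> \<le> of_nat k * (y * pnorm2 q)"
    using k(1) y by (simp add: mult_right_mono pnorm2_def)
  finally have "l (\<Sum>\<^sub># U) \<le> of_nat k * (y * pnorm2 q)" .
  moreover have "l (\<Sum>\<^sub># U) = of_nat k * (2 * (y * pnorm2 q) + pIm q)"
    by (simp add: l_def mean pRe_mult pIm_mult pnorm2_def power2_eq_square algebra_simps)
  ultimately have "of_nat k * (y * pnorm2 q + pIm q) \<le> 0"
    by (simp add: algebra_simps)
  with k(2) show ?thesis by (simp add: mult_le_0_iff)
qed

theorem laguerre: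
  assumes stable: "stable_poly p" and deg: "degree p \<le> k" and k: "0 < k"
    and z: "0 < pIm z" and w: "0 < pIm w"
  shows "of_nat k * poly p z + (w - z) * poly (pderiv p) z \<noteq> 0"
proof
  assume zero: "of_nat k * poly p z + (w - z) * poly (pderiv p) z = 0"
  obtain R where size_R: "size R = degree p"
    and p: "p = smult (lead_coeff p) (\<Prod>r\<in>#R. [:- r, 1:])"
    and roots: "\<And>r. r \<in># R \<Longrightarrow> pIm r \<le> 0"
    using stable_poly_factorization[OF stable] by blast
  have "z \<notin># R" using roots[of z] z by auto
  define U where "U = image_mset (\<lambda>r. inverse (z - r)) R"
  have "poly (pderiv p) z = poly p z * \<Sum>\<^sub># U"
    by (subst (1 2) p) (simp only: poly_pderiv_prod_linear[OF \<open>z \<notin># R\<close>] U_def)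
  with zero have "poly p z * (of_nat k - (z - w) * \<Sum>\<^sub># U) = 0" by (simp add: algebra_simps)
  moreover have "poly p z \<noteq> 0" using stable z by (simp add: stable_poly_def)
  ultimately have sum_U: "(z - w) * \<Sum>\<^sub># U = of_nat k" by simp
  then have "z - w \<noteq> 0" using k by auto
  have "pIm z * pnorm2 (inverse (z - w)) + pIm (inverse (z - w)) \<le> 0"
  proof (rule disc_mean[OF z])
    show "\<Sum>\<^sub># U = of_nat k * inverse (z - w)"
      using sum_U \<open>z - w \<noteq> 0\<close> by (simp add: field_simps)
    show "size U \<le> k" using deg size_R by (simp add: U_def)
  next
    fix u assume "u \<in># U"
    then obtain r where r: "r \<in># R" "u = inverse (z - r)" by (auto simp: U_def)
    with \<open>z \<notin># R\<close> have "z - r \<noteq> 0" by auto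
    with r roots pnorm2_pos[of "z - r"] show "pIm z * pnorm2 u + pIm u \<le> 0"
      by (simp add: pnorm2_pIm_inverse divide_le_0_iff)
  qed (rule k)
  moreover have "0 < pIm z * pnorm2 (inverse (z - w)) + pIm (inverse (z - w))"
    using w pnorm2_pos[OF \<open>z - w \<noteq> 0\<close>] \<open>z - w \<noteq> 0\<close> by (simp add: pnorm2_pIm_inverse)
  ultimately show False by simp
qed

definition polar_deriv :: "nat \<Rightarrow> 'a::idom \<Rightarrow> 'a poly \<Rightarrow> 'a poly"
  where "polar_deriv k w p = smult (of_nat k) p + [:w, - 1:] * pderiv p"

lemma coeff_polar_deriv:
  "coeff (polar_deriv k w p) i =
    (of_nat k - of_nat i) * coeff p i + w * of_nat (Suc i) * coeff p (Suc i)"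
  by (cases i) (simp_all add: polar_deriv_def coeff_pderiv coeff_pCons algebra_simps)

lemma degree_polar_deriv_le:
  assumes "degree p \<le> Suc n"
  shows "degree (polar_deriv (Suc n) w p) \<le> n"
proof (rule degree_le, intro allI impI)
  fix i assume "n < i"
  with assms have "coeff p (Suc i) = 0" "i = Suc n \<or> coeff p i = 0"
    by (auto intro: coeff_eq_0)
  then show "coeff (polar_deriv (Suc n) w p) i = 0" by (auto simp: coeff_polar_deriv)
qed

lemma stable_poly_polar_deriv:
  "stable_poly p \<Longrightarrow> degree p \<le> k \<Longrightarrow> 0 < k \<Longrightarrow> 0 < pIm w \<Longrightarrow> stable_poly (polar_deriv k w p)"
  using laguerre[of p k _ w] by (simp add: stable_poly_def polar_deriv_def algebra_simps)

lemma sum_Pow_insert: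
  assumes "finite I" "a \<notin> I"
  shows "(\<Sum>T\<in>Pow (insert a I). f T) = (\<Sum>T\<in>Pow I. f T) + (\<Sum>T\<in>Pow I. f (insert a T))"
proof -
  have "(\<Sum>T\<in>Pow (insert a I). f T) = (\<Sum>T\<in>Pow I. f T) + (\<Sum>T\<in>insert a ` Pow I. f T)"
    unfolding Pow_insert using assms by (intro sum.union_disjoint) auto
  also have "(\<Sum>T\<in>insert a ` Pow I. f T) = (\<Sum>T\<in>Pow I. f (insert a T))"
    using assms by (subst sum.reindex) (auto simp: inj_on_def insert_eq_iff)
  finally show ?thesis .
qed

definition esym :: "'e set \<Rightarrow> ('e \<Rightarrow> 'a::comm_ring_1) \<Rightarrow> nat \<Rightarrow> 'a"
  where "esym I z k = (\<Sum>T\<in>Pow I. if card T = k then \<Prod>e\<in>T. z e else 0)"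

lemma esym_eq_0: "finite I \<Longrightarrow> card I < k \<Longrightarrow> esym I z k = 0"
  unfolding esym_def by (rule sum.neutral) (auto dest: card_mono)

lemma esym_insert:
  assumes "finite I" "a \<notin> I"
  shows "esym (insert a I) z k = esym I z k + (case k of 0 \<Rightarrow> 0 | Suc j \<Rightarrow> z a * esym I z j)"
proof -
  have "(if card (insert a T) = k then \<Prod>e\<in>insert a T. z e else 0) =
      (case k of 0 \<Rightarrow> 0 | Suc j \<Rightarrow> z a * (if card T = j then \<Prod>e\<in>T. z e else 0))" if "T \<in> Pow I" for T
  proof -
    have "finite T" "a \<notin> T" using that assms finite_subset by auto
    then show ?thesis by (simp split: nat.split)
  qed
  then have "(\<Sum>T\<in>Pow I. if card (insert a T) = k then \<Prod>e\<in>insert a T. z e else 0) =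
      (case k of 0 \<Rightarrow> 0 | Suc j \<Rightarrow> z a * esym I z j)"
    by (simp add: esym_def sum_distrib_left split: nat.split)
  then show ?thesis unfolding esym_def sum_Pow_insert[OF assms] by simp
qed

lemma
  assumes "i \<le> n"
  shows Suc_diff_divide_binomial: "(of_nat (Suc n) - of_nat i) / of_nat (n choose i) =
      of_nat (Suc n) / (of_nat (Suc n choose i) :: 'a::field_char_0)"
    and Suc_divide_binomial: "of_nat (Suc i) / of_nat (n choose i) =
      of_nat (Suc n) / (of_nat (Suc n choose Suc i) :: 'a)"
proof -
  have "(Suc n - i) * (Suc n choose i) = Suc n * (n choose i)"
    using binomial_absorb_comp[of "Suc n" i] by simp
  then have "of_nat (Suc n - i) * of_nat (Suc n choose i) =
      (of_nat (Suc n) * of_nat (n choose i) :: 'a)"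
    by (metis of_nat_mult)
  moreover have "of_nat (Suc i) * of_nat (Suc n choose Suc i) =
      (of_nat (Suc n) * of_nat (n choose i) :: 'a)"
    by (metis of_nat_mult Suc_times_binomial)
  moreover have "of_nat (n choose i) \<noteq> (0 :: 'a)" "of_nat (Suc n choose i) \<noteq> (0 :: 'a)"
    "of_nat (Suc n choose Suc i) \<noteq> (0 :: 'a)"
    using assms by (simp_all del: binomial_Suc_Suc)
  ultimately show "(of_nat (Suc n) - of_nat i) / of_nat (n choose i) =
      of_nat (Suc n) / (of_nat (Suc n choose i) :: 'a)"
    "of_nat (Suc i) / of_nat (n choose i) = of_nat (Suc n) / (of_nat (Suc n choose Suc i) :: 'a)"
    using assms by (simp_all add: frac_eq_eq mult.commute del: of_nat_Suc binomial_Suc_Suc)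
qed

lemma sum_polar_deriv_esym:
  fixes z :: "'e \<Rightarrow> 'a::field_char_0"
  assumes I: "finite I" "a \<notin> I" and n: "card I = n"
  shows "(\<Sum>i\<le>n. coeff (polar_deriv (Suc n) (z a) p) i * (esym I z i / of_nat (n choose i))) =
    of_nat (Suc n) * (\<Sum>i\<le>Suc n. coeff p i * (esym (insert a I) z i / of_nat (Suc n choose i)))"
proof -
  define e where "e = esym I z"
  define b where "b i = coeff p i / of_nat (Suc n choose i)" for i
  have "coeff (polar_deriv (Suc n) (z a) p) i * (e i / of_nat (n choose i)) =
      of_nat (Suc n) * (b i * e i + b (Suc i) * (z a * e i))" if "i \<le> n" for i
  proof -
    have "coeff (polar_deriv (Suc n) (z a) p) i * (e i / of_nat (n choose i)) =
        (of_nat (Suc n) - of_nat i) / of_nat (n choose i) * (coeff p i * e i) +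
        of_nat (Suc i) / of_nat (n choose i) * (coeff p (Suc i) * (z a * e i))"
      by (simp add: coeff_polar_deriv add_divide_distrib diff_divide_distrib algebra_simps
          del: of_nat_Suc)
    then show ?thesis
      unfolding Suc_diff_divide_binomial[OF that] Suc_divide_binomial[OF that]
      by (simp add: b_def algebra_simps del: of_nat_Suc binomial_Suc_Suc)
  qed
  then have "(\<Sum>i\<le>n. coeff (polar_deriv (Suc n) (z a) p) i * (e i / of_nat (n choose i))) =
      (\<Sum>i\<le>n. of_nat (Suc n) * (b i * e i + b (Suc i) * (z a * e i)))"
    by simp
  also have "\<dots> = of_nat (Suc n) * ((\<Sum>i\<le>n. b i * e i) + (\<Sum>i\<le>n. b (Suc i) * (z a * e i)))"
    by (simp only: sum_distrib_left sum.distrib distrib_left)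
  also have "(\<Sum>i\<le>n. b i * e i) = (\<Sum>i\<le>Suc n. b i * e i)"
    using I n by (simp add: e_def esym_eq_0)
  also have "\<dots> + (\<Sum>i\<le>n. b (Suc i) * (z a * e i)) = (\<Sum>i\<le>Suc n. b i * esym (insert a I) z i)"
    using I by (simp add: sum.atMost_Suc_shift e_def esym_insert sum.distrib distrib_left
        del: sum.atMost_Suc)
  finally show ?thesis by (simp add: e_def b_def)
qed

theorem grace_walsh_szego:
  assumes "finite I" "stable_poly p" "degree p \<le> card I" "\<And>e. e \<in> I \<Longrightarrow> 0 < pIm (z e)"
  shows "(\<Sum>i\<le>card I. coeff p i * (esym I z i / of_nat (card I choose i))) \<noteq> 0"
  using assms
proof (induction I arbitrary: p rule: finite_induct)
  case empty
  have "poly p (pconst \<i>) \<noteq> 0" using empty.prems(1) by (simp add: stable_poly_def)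
  with empty.prems(2) show ?case by (auto simp: esym_def elim!: degree_eq_zeroE)
next
  case (insert a I)
  define n where "n = card I"
  have card: "card (insert a I) = Suc n" using insert.hyps by (simp add: n_def)
  let ?q = "polar_deriv (Suc n) (z a) p"
  have "stable_poly ?q" "degree ?q \<le> n"
    using insert.prems by (auto simp: card intro: stable_poly_polar_deriv degree_polar_deriv_le)
  then have "(\<Sum>i\<le>n. coeff ?q i * (esym I z i / of_nat (n choose i))) \<noteq> 0"
    using insert.IH[of ?q] insert.prems(3) by (simp add: n_def)
  then show ?case
    unfolding sum_polar_deriv_esym[OF insert.hyps n_def[symmetric]] card by simp
qed

lemma degree_prod_linear: "degree (\<Prod>r\<in>#R. [:- r, 1:]) = size R"
  for R :: "'a::idom multiset"
proof (induction R)
  case (add r R)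
  have "(\<Prod>r\<in>#R. [:- r, 1:]) \<noteq> 0" by auto
  then have "degree ([:- r, 1:] * (\<Prod>r\<in>#R. [:- r, 1:])) = Suc (size R)"
    using add by (subst degree_mult_eq) auto
  then show ?case by simp
qed simp

lemma coeff_prod_linear_size: "coeff (\<Prod>r\<in>#R. [:- r, 1:]) (size R) = 1"
  for R :: "'a::idom multiset"
  by (induction R) (simp_all add: coeff_eq_0 degree_prod_linear)

lemma coeff_prod_linear_subleading:
  fixes R :: "'a::idom multiset"
  assumes "size R = Suc k"
  shows "coeff (\<Prod>r\<in>#R. [:- r, 1:]) k = - \<Sum>\<^sub># R"
  using assms
proof (induction R arbitrary: k)
  case (add r R)
  then have "k = size R" by simp
  with add.IH coeff_prod_linear_size[of R] show ?case
    by (cases "size R") (simp_all add: coeff_pCons)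
qed simp

lemma sum_mset_negf: "(\<Sum>x\<in>#A. - f x) = - (\<Sum>x\<in>#A. f x)"
  for f :: "'b \<Rightarrow> 'a::ab_group_add"
  by (induction A) simp_all

lemma valuation_le_sum_mset:
  assumes nonneg: "\<And>r. r \<in># R \<Longrightarrow> 0 \<le> pIm (f r)" and y: "y \<in># R" "Im (leading_coeff (f y)) \<noteq> 0"
  shows "valuation (f y) \<le> valuation (\<Sum>r\<in>#R. f r)"
proof -
  obtain R' where R: "R = add_mset y R'" using y(1) by (metis mset_add)
  have "0 \<le> (\<Sum>r\<in>#R'. pIm (f r))"
    using nonneg sum_mset_mono[of R' "\<lambda>_. 0" "\<lambda>r. pIm (f r)"] by (simp add: R)
  then have "pIm (f y) \<le> pIm (\<Sum>r\<in>#R. f r)" by (simp add: R pIm_sum_mset)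
  then have "valuation (pIm (f y)) \<le> valuation (pIm (\<Sum>r\<in>#R. f r))"
    using nonneg[OF y(1)] by (rule valuation_mono[rotated])
  with y(2) valuation_pIm_le show ?thesis by (metis valuation_pIm_eq order_trans)
qed

lemma nonreal_root_exists:
  assumes p: "p = smult l (\<Prod>r\<in>#R. [:- r, 1:])" "l \<noteq> 0"
    and nonreal: "Im (leading_coeff (coeff p 0 / l)) \<noteq> 0"
  shows "\<exists>y\<in>#R. Im (leading_coeff y) \<noteq> 0"
proof (rule ccontr)
  assume "\<not> (\<exists>y\<in>#R. Im (leading_coeff y) \<noteq> 0)"
  then have "Im (leading_coeff (\<Prod>r\<in>#R. - r)) = 0"
    by (induction R) (simp_all add: leading_coeff_mult)
  moreover have "coeff p 0 / l = (\<Prod>r\<in>#R. - r)"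
    using p(2) by (simp add: p(1) poly_prod_mset flip: poly_0_coeff_0)
  ultimately show False using nonreal by simp
qed

text \<open>All roots lie in the closed lower half-plane, and some root has a leading coefficient that is not
  real. Its imaginary part cannot be cancelled in the sum of all roots, nor in the sum of their
  reciprocals.\<close>

theorem stable_poly_coeff_valuation:
  assumes p: "stable_poly p" and nonreal: "Im (leading_coeff (coeff p 0 / lead_coeff p)) \<noteq> 0"
  shows "valuation (coeff p 0) + valuation (lead_coeff p)
    \<le> valuation (coeff p 1) + valuation (coeff p (degree p - 1))"
proof -
  define l where "l = lead_coeff p"
  obtain R where size: "size R = degree p" and pR: "p = smult l (\<Prod>r\<in>#R. [:- r, 1:])"
    and "l \<noteq> 0" and roots: "\<And>r. r \<in># R \<Longrightarrow> pIm r \<le> 0"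
    using stable_poly_factorization[OF p] unfolding l_def by blast
  obtain y where y: "y \<in># R" "Im (leading_coeff y) \<noteq> 0"
    using nonreal_root_exists[OF pR \<open>l \<noteq> 0\<close>] nonreal by (auto simp: l_def)
  have "coeff p 0 \<noteq> 0" using nonreal by auto
  then have "0 \<notin># R"
    using pR by (auto simp: poly_prod_mset simp flip: poly_0_coeff_0)
  have "valuation (- y) \<le> valuation (\<Sum>r\<in>#R. - r)"
    by (rule valuation_le_sum_mset) (use roots y in auto)
  then have sum: "valuation y \<le> valuation (\<Sum>\<^sub># R)" by (simp add: sum_mset_negf)
  have "valuation (inverse y) \<le> valuation (\<Sum>r\<in>#R. inverse r)"
  proof (rule valuation_le_sum_mset[OF _ y(1)])
    fix r assume "r \<in># R"
    with \<open>0 \<notin># R\<close> roots show "0 \<le> pIm (inverse r)" by (metis pIm_inverse_sign(2))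
  next
    show "Im (leading_coeff (inverse y)) \<noteq> 0"
      using y(2) by (simp add: inverse_eq_divide leading_coeff_divide Im_divide)
  qed
  moreover have "y \<noteq> 0" using y by auto
  ultimately have inv: "- valuation y \<le> valuation (\<Sum>r\<in>#R. inverse r)"
    by (simp add: valuation_inverse)
  have "poly (pderiv p) 0 = poly p 0 * (\<Sum>r\<in>#R. inverse (0 - r))"
    by (subst (1 2) pR) (rule poly_pderiv_prod_linear[OF \<open>0 \<notin># R\<close>])
  then have "coeff p 1 = - (coeff p 0 * (\<Sum>r\<in>#R. inverse r))"
    by (simp add: poly_0_coeff_0 coeff_pderiv sum_mset_negf)
  moreover have "size R = Suc (degree p - 1)" using size y(1) by (cases R) auto
  then have "coeff p (degree p - 1) = - (l * \<Sum>\<^sub># R)"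
    by (subst pR) (simp add: coeff_prod_linear_subleading)
  ultimately show ?thesis
    using sum inv \<open>y \<noteq> 0\<close> \<open>coeff p 0 \<noteq> 0\<close> \<open>l \<noteq> 0\<close>
    by (cases "valuation (\<Sum>\<^sub># R)"; cases "valuation (\<Sum>r\<in>#R. inverse r)")
      (simp_all add: valuation_mult valuation_nonzero flip: l_def)
qed


section \<open>Stable multiaffine polynomials\<close>

definition multiaffine_eval :: "'e set \<Rightarrow> ('e set \<Rightarrow> 'a::comm_ring_1) \<Rightarrow> ('e \<Rightarrow> 'a) \<Rightarrow> 'a"
  where "multiaffine_eval E c Z = (\<Sum>S\<in>Pow E. c S * (\<Prod>e\<in>S. Z e))"

definition multiaffine_stable :: "'e set \<Rightarrow> ('e set \<Rightarrow> complex puiseux) \<Rightarrow> bool"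
  where "multiaffine_stable E c \<longleftrightarrow> (\<forall>Z. (\<forall>e\<in>E. 0 < pIm (Z e)) \<longrightarrow> multiaffine_eval E c Z \<noteq> 0)"

lemma multiaffine_stableI:
  "(\<And>Z. (\<And>e. e \<in> E \<Longrightarrow> 0 < pIm (Z e)) \<Longrightarrow> multiaffine_eval E c Z \<noteq> 0) \<Longrightarrow> multiaffine_stable E c"
  by (simp add: multiaffine_stable_def)

lemma multiaffine_stableD:
  "multiaffine_stable E c \<Longrightarrow> (\<And>e. e \<in> E \<Longrightarrow> 0 < pIm (Z e)) \<Longrightarrow> multiaffine_eval E c Z \<noteq> 0"
  by (simp add: multiaffine_stable_def)

lemma multiaffine_eval_empty [simp]: "multiaffine_eval {} c Z = c {}"
  by (simp add: multiaffine_eval_def)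

lemma multiaffine_eval_cong:
  "(\<And>e. e \<in> E \<Longrightarrow> Z e = Z' e) \<Longrightarrow> multiaffine_eval E c Z = multiaffine_eval E c Z'"
  unfolding multiaffine_eval_def by (intro sum.cong prod.cong arg_cong2[of _ _ _ _ "(*)"]) auto

lemma multiaffine_eval_insert:
  assumes "finite I" "a \<notin> I"
  shows "multiaffine_eval (insert a I) c Z =
    multiaffine_eval I c Z + Z a * multiaffine_eval I (\<lambda>S. c (insert a S)) Z"
proof -
  have "c (insert a S) * (\<Prod>e\<in>insert a S. Z e) = Z a * (c (insert a S) * (\<Prod>e\<in>S. Z e))"
    if "S \<in> Pow I" for S
  proof -
    have "finite S" "a \<notin> S" using that assms finite_subset by auto
    then show ?thesis by (simp add: mult_ac)
  qed
  then show ?thesis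
    unfolding multiaffine_eval_def sum_Pow_insert[OF assms] by (simp add: sum_distrib_left)
qed

lemma multiaffine_eval_add_mult:
  "multiaffine_eval E (\<lambda>S. c S + z * d S) Z = multiaffine_eval E c Z + z * multiaffine_eval E d Z"
  by (simp add: multiaffine_eval_def sum_distrib_left sum.distrib distrib_right mult.assoc)

lemma multiaffine_eval_slice:
  assumes "finite I" "a \<notin> I"
  shows "multiaffine_eval (insert a I) c (Z(a := z)) =
    multiaffine_eval I (\<lambda>S. c S + z * c (insert a S)) Z"
proof -
  have "multiaffine_eval I c (Z(a := z)) = multiaffine_eval I c Z" for c
    by (rule multiaffine_eval_cong) (use assms(2) in auto)
  then show ?thesis by (simp add: multiaffine_eval_insert[OF assms] multiaffine_eval_add_mult)
qed

lemma multiaffine_stable_slice: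
  assumes "finite I" "a \<notin> I" "multiaffine_stable (insert a I) c" "0 < pIm z"
  shows "multiaffine_stable I (\<lambda>S. c S + z * c (insert a S))"
proof (rule multiaffine_stableI)
  fix Z assume "\<And>e. e \<in> I \<Longrightarrow> 0 < pIm (Z e)"
  then have "multiaffine_eval (insert a I) c (Z(a := z)) \<noteq> 0"
    using assms(4) by (intro multiaffine_stableD[OF assms(3)]) auto
  then show "multiaffine_eval I (\<lambda>S. c S + z * c (insert a S)) Z \<noteq> 0"
    by (simp only: multiaffine_eval_slice[OF assms(1,2)] not_False_eq_True)
qed

text \<open>Solving for \<open>x\<close> gives a Moebius transformation in \<open>z\<close> that vanishes at \<open>z\<^sub>0\<close>; unless it is
  constant, it maps some point near \<open>z\<^sub>0\<close> to the upper half-plane.\<close>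

lemma affine_pencil_constant:
  assumes z0: "0 < pIm z0"
    and nz: "\<And>z x. 0 < pIm z \<Longrightarrow> 0 < pIm x \<Longrightarrow> b * (z - z0) + x * (m + d * (z - z0)) \<noteq> 0"
  shows "b = 0"
proof (rule ccontr)
  assume "b \<noteq> 0"
  define u e where "u = m / b" and "e = d / b"
  have "0 < pIm z0 / (\<bar>pRe u\<bar> + 1)" "0 < 1 / (\<bar>pIm e\<bar> + 1)"
    using z0 by (simp_all add: add_nonneg_pos)
  then obtain h where "0 < h" "h < pIm z0 / (\<bar>pRe u\<bar> + 1)" "h < 1 / (\<bar>pIm e\<bar> + 1)"
    using field_lbound_gt_zero by blast
  then have "0 < h" and "h * \<bar>pRe u\<bar> + h < pIm z0" "h * \<bar>pIm e\<bar> + h < 1"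
    by (simp_all add: pos_less_divide_eq add_nonneg_pos distrib_left)
  moreover have "h * pRe u \<le> h * \<bar>pRe u\<bar>" "- (h * pIm e) \<le> h * \<bar>pIm e\<bar>"
    using \<open>0 < h\<close> mult_left_mono[of "pRe u" "\<bar>pRe u\<bar>" h] mult_left_mono[of "- pIm e" "\<bar>pIm e\<bar>" h]
    by simp_all
  ultimately have h: "0 < h" "h * pRe u < pIm z0" "- (h * pIm e) < 1" by linarith+
  define v where "v = - (pconst \<i> * pcomplex_of_real h)"
  have v: "pRe v = 0" "pIm v = - h" by (simp_all add: v_def pRe_mult pIm_mult pconst_1)
  then have "v \<noteq> 0" using h(1) by auto
  define z y where "z = z0 + u * v" and "y = - inverse v - e"
  have "0 < pIm z" using h(2) by (simp add: z_def pIm_mult v mult.commute)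
  have "pIm y = - (1 / h) - pIm e"
    using \<open>v \<noteq> 0\<close> h(1) by (simp add: y_def pIm_inverse pnorm2_def v power2_eq_square)
  also have "\<dots> < 0" using h(1,3) by (simp add: field_simps)
  finally have "pIm y < 0" .
  then have "y \<noteq> 0" by auto
  then have "0 < pIm (inverse y)" using \<open>pIm y < 0\<close> by (simp add: pIm_inverse_sign)
  have "m + d * (z - z0) = - (y * (m * v))"
    using \<open>v \<noteq> 0\<close> by (simp add: z_def y_def u_def e_def field_simps)
  then have "b * (z - z0) + inverse y * (m + d * (z - z0)) = 0"
    using \<open>b \<noteq> 0\<close> \<open>y \<noteq> 0\<close> by (simp add: z_def u_def)
  then show False using nz[OF \<open>0 < pIm z\<close> \<open>0 < pIm (inverse y)\<close>] by contradiction
qed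

lemma multiaffine_zero_slice:
  assumes fin: "finite F" and new: "e \<notin> insert f F" "f \<notin> F"
    and stable: "multiaffine_stable (insert e (insert f F)) c"
    and upper: "\<And>a. a \<in> insert e F \<Longrightarrow> 0 < pIm (Z a)" and zero: "multiaffine_eval (insert e F) c Z = 0"
  shows "multiaffine_eval F (\<lambda>S. c S + z * c (insert e S)) Z = 0"
proof -
  define \<alpha> \<beta> \<gamma> \<delta> where "\<alpha> = multiaffine_eval F c Z"
    and "\<beta> = multiaffine_eval F (\<lambda>S. c (insert e S)) Z"
    and "\<gamma> = multiaffine_eval F (\<lambda>S. c (insert f S)) Z"
    and "\<delta> = multiaffine_eval F (\<lambda>S. c (insert e (insert f S))) Z"
  have \<alpha>: "\<alpha> = - (Z e * \<beta>)"
    using zero fin new by (simp add: multiaffine_eval_insert \<alpha>_def \<beta>_def eq_neg_iff_add_eq_0)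
  have "\<beta> = 0"
  proof (rule affine_pencil_constant)
    show "0 < pIm (Z e)" using upper by simp
    fix z x assume z: "0 < pIm z" and x: "0 < pIm x"
    have "multiaffine_stable (insert f F) (\<lambda>S. c S + z * c (insert e S))"
      using fin new z by (intro multiaffine_stable_slice[OF _ _ stable]) auto
    then have "multiaffine_eval (insert f F) (\<lambda>S. c S + z * c (insert e S)) (Z(f := x)) \<noteq> 0"
      by (rule multiaffine_stableD) (use x upper in auto)
    then have "\<alpha> + x * \<gamma> + z * (\<beta> + x * \<delta>) \<noteq> 0"
      using fin new by (simp add: multiaffine_eval_slice multiaffine_eval_add_mult
          \<alpha>_def \<beta>_def \<gamma>_def \<delta>_def)
    then show "\<beta> * (z - Z e) + x * ((\<gamma> + Z e * \<delta>) + \<delta> * (z - Z e)) \<noteq> 0"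
      by (simp add: \<alpha> algebra_simps)
  qed
  with \<alpha> show ?thesis by (simp add: multiaffine_eval_add_mult \<alpha>_def \<beta>_def)
qed

lemma multiaffine_stable_zero:
  assumes "finite F" "f \<notin> F" "multiaffine_stable (insert f F) c"
    and "\<And>e. e \<in> F \<Longrightarrow> 0 < pIm (Z e)" "multiaffine_eval F c Z = 0" "S \<subseteq> F"
  shows "c S = 0"
  using assms
proof (induction F arbitrary: c S rule: finite_induct)
  case empty
  then show ?case by simp
next
  case (insert e F)
  have new: "e \<notin> insert f F" "f \<notin> F" using insert.hyps insert.prems(1) by auto
  have stable: "multiaffine_stable (insert e (insert f F)) c"
    using insert.prems(2) by (simp add: insert_commute)
  have vanish: "c T + z * c (insert e T) = 0" if "T \<subseteq> F" "0 < pIm z" for T z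
  proof (rule insert.IH[of "\<lambda>S. c S + z * c (insert e S)" T, OF new(2)])
    show "multiaffine_stable (insert f F) (\<lambda>S. c S + z * c (insert e S))"
      using insert.hyps(1) new that(2) by (intro multiaffine_stable_slice[OF _ _ stable]) auto
    show "multiaffine_eval F (\<lambda>S. c S + z * c (insert e S)) Z = 0"
      using insert.hyps(1) new stable insert.prems(3,4)
      by (intro multiaffine_zero_slice) auto
  qed (use insert.prems(3) that(1) in auto)
  have "c T = 0 \<and> c (insert e T) = 0" if "T \<subseteq> F" for T
  proof -
    have "c T + pconst \<i> * c (insert e T) = 0" "c T + (pconst \<i> + 1) * c (insert e T) = 0"
      by (rule vanish[OF that], simp)+
    then show ?thesis by algebra
  qed
  from this[of "S - {e}"] insert.prems(5) show ?case
    by (cases "e \<in> S") (auto simp: insert_absorb)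
qed

lemma multiaffine_stable_subset:
  assumes "finite E" "multiaffine_stable E c" "F \<subseteq> E" "S \<subseteq> F" "c S \<noteq> 0"
  shows "multiaffine_stable F c"
proof -
  have "multiaffine_stable F c" if "finite D" "multiaffine_stable (F \<union> D) c" "D \<inter> F = {}" for D
    using that
  proof (induction D rule: finite_induct)
    case (insert f D)
    have "finite (F \<union> D)" using assms(1,3) insert.hyps finite_subset by auto
    have "multiaffine_stable (F \<union> D) c"
    proof (rule multiaffine_stableI, rule notI)
      fix Z assume "\<And>e. e \<in> F \<union> D \<Longrightarrow> 0 < pIm (Z e)" "multiaffine_eval (F \<union> D) c Z = 0"
      then have "c S = 0"
        using \<open>finite (F \<union> D)\<close> insert.hyps insert.prems assms(4)
        by (intro multiaffine_stable_zero[of "F \<union> D" f c Z]) auto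
      with assms(5) show False by contradiction
    qed
    with insert show ?case by auto
  qed simp
  moreover have "F \<union> (E - F) = E" "(E - F) \<inter> F = {}" using assms(3) by auto
  ultimately show ?thesis using assms(1,2) by (metis finite_Diff)
qed

text \<open>Substituting \<open>- 1 / z\<^sub>e\<close> for the variables \<open>e \<in> A\<close> moves \<open>A\<close> to the empty set.\<close>

lemma multiaffine_eval_reflect:
  fixes Z :: "'e \<Rightarrow> 'a::field"
  assumes fin: "finite E" and A: "A \<subseteq> E" and nz: "\<And>e. e \<in> A \<Longrightarrow> Z e \<noteq> 0"
  shows "multiaffine_eval E (\<lambda>S. (- 1) ^ card (A - S) * c (sym_diff S A)) Z =
    (\<Prod>e\<in>A. Z e) * multiaffine_eval E c (\<lambda>e. if e \<in> A then - inverse (Z e) else Z e)"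
proof -
  define Y where "Y e = (if e \<in> A then - inverse (Z e) else Z e)" for e
  have prods: "(\<Prod>e\<in>A. Z e) * (\<Prod>e\<in>S. Y e) = (- 1) ^ card (S \<inter> A) * (\<Prod>e\<in>sym_diff S A. Z e)"
    if S: "S \<subseteq> E" for S
  proof -
    have fins: "finite S" "finite A" using S A fin finite_subset by blast+
    have "(\<Prod>e\<in>A. Z e) = (\<Prod>e\<in>S \<inter> A. Z e) * (\<Prod>e\<in>A - S. Z e)"
      using prod.Int_Diff[OF fins(2), of Z S] by (simp add: Int_commute)
    moreover have "(\<Prod>e\<in>S. Y e) = (\<Prod>e\<in>S \<inter> A. - inverse (Z e)) * (\<Prod>e\<in>S - A. Z e)"
      unfolding Y_def using fins(1) by (simp add: prod.If_cases Diff_eq)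
    moreover have "(\<Prod>e\<in>S \<inter> A. Z e) * (\<Prod>e\<in>S \<inter> A. - inverse (Z e)) = (\<Prod>e\<in>S \<inter> A. - 1)"
      unfolding prod.distrib[symmetric] using nz by (intro prod.cong) auto
    moreover have "(\<Prod>e\<in>sym_diff S A. Z e) = (\<Prod>e\<in>S - A. Z e) * (\<Prod>e\<in>A - S. Z e)"
      using fins by (intro prod.union_disjoint) auto
    ultimately show ?thesis by (simp add: mult_ac)
  qed
  have "(\<Sum>S\<in>Pow E. (- 1) ^ card (A - S) * c (sym_diff S A) * (\<Prod>e\<in>S. Z e)) =
      (\<Sum>S\<in>Pow E. c S * ((\<Prod>e\<in>A. Z e) * (\<Prod>e\<in>S. Y e)))"
  proof (rule sum.reindex_bij_witness[of _ "\<lambda>S. sym_diff S A" "\<lambda>S. sym_diff S A"])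
    fix S assume "S \<in> Pow E"
    then have "sym_diff S A \<subseteq> E" using A by auto
    moreover have "sym_diff S A \<inter> A = A - S" "sym_diff (sym_diff S A) A = S" by auto
    ultimately show "c (sym_diff S A) * ((\<Prod>e\<in>A. Z e) * (\<Prod>e\<in>sym_diff S A. Y e)) =
        (- 1) ^ card (A - S) * c (sym_diff S A) * (\<Prod>e\<in>S. Z e)"
      by (simp only: prods mult_ac)
  qed (use A in auto)
  then show ?thesis by (simp add: multiaffine_eval_def Y_def sum_distrib_left mult_ac)
qed

lemma multiaffine_stable_reflect:
  assumes fin: "finite E" and stable: "multiaffine_stable E c" and A: "A \<subseteq> E"
  shows "multiaffine_stable E (\<lambda>S. (- 1) ^ card (A - S) * c (sym_diff S A))"
proof (rule multiaffine_stableI)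
  fix Z :: "'a \<Rightarrow> complex puiseux"
  assume Z: "\<And>e. e \<in> E \<Longrightarrow> 0 < pIm (Z e)"
  then have nz: "Z e \<noteq> 0" if "e \<in> E" for e using Z[OF that] by auto
  have "multiaffine_eval E c (\<lambda>e. if e \<in> A then - inverse (Z e) else Z e) \<noteq> 0"
  proof (rule multiaffine_stableD[OF stable])
    fix e assume "e \<in> E"
    with Z nz have "pIm (inverse (Z e)) < 0" by (simp add: pIm_inverse_sign(2) not_le[symmetric])
    with Z \<open>e \<in> E\<close> show "0 < pIm (if e \<in> A then - inverse (Z e) else Z e)" by simp
  qed
  moreover have "Z e \<noteq> 0" if "e \<in> A" for e using nz A that by blast
  moreover from this have "(\<Prod>e\<in>A. Z e) \<noteq> 0" using finite_subset[OF A fin] by simp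
  ultimately show "multiaffine_eval E (\<lambda>S. (- 1) ^ card (A - S) * c (sym_diff S A)) Z \<noteq> 0"
    using multiaffine_eval_reflect[OF fin A, of Z c] by simp
qed

definition multiaffine_line :: "'e set \<Rightarrow> 'e set \<Rightarrow> ('e set \<Rightarrow> 'a::comm_ring_1) \<Rightarrow> ('e \<Rightarrow> 'a) \<Rightarrow> 'a poly"
  where "multiaffine_line E F c W = (\<Sum>S\<in>Pow E. monom (c S * (\<Prod>e\<in>S. W e)) (card (S \<inter> F)))"

lemma poly_multiaffine_line:
  assumes "finite E"
  shows "poly (multiaffine_line E F c W) x =
    multiaffine_eval E c (\<lambda>e. if e \<in> F then W e * x else W e)"
proof -
  have "(\<Prod>e\<in>S. if e \<in> F then W e * x else W e) = (\<Prod>e\<in>S. W e) * x ^ card (S \<inter> F)"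
    if "S \<in> Pow E" for S
  proof -
    have "finite S" using that assms finite_subset by auto
    moreover have "(\<Prod>e\<in>S. if e \<in> F then W e * x else W e) = (\<Prod>e\<in>S. W e * (if e \<in> F then x else 1))"
      by (intro prod.cong) auto
    ultimately show ?thesis by (simp add: prod.distrib prod.inter_restrict[symmetric])
  qed
  then show ?thesis
    by (simp add: multiaffine_line_def multiaffine_eval_def poly_sum poly_monom mult.assoc)
qed

lemma coeff_multiaffine_line:
  assumes "finite E" "\<S> \<subseteq> Pow E"
    and "\<And>S. S \<subseteq> E \<Longrightarrow> c S \<noteq> 0 \<Longrightarrow> card (S \<inter> F) = i \<longleftrightarrow> S \<in> \<S>"
  shows "coeff (multiaffine_line E F c W) i = (\<Sum>S\<in>\<S>. c S * (\<Prod>e\<in>S. W e))"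
  unfolding multiaffine_line_def coeff_sum coeff_monom
proof (rule sum.mono_neutral_cong_right)
  have "c S * (\<Prod>e\<in>S. W e) = 0 \<or> (card (S \<inter> F) = i \<longleftrightarrow> S \<in> \<S>)" if "S \<in> Pow E" for S
    using assms(3)[of S] that by (cases "c S = 0") auto
  then show "\<forall>S\<in>Pow E - \<S>. (if card (S \<inter> F) = i then c S * (\<Prod>e\<in>S. W e) else 0) = 0"
    "\<And>S. S \<in> \<S> \<Longrightarrow> (if card (S \<inter> F) = i then c S * (\<Prod>e\<in>S. W e) else 0) = c S * (\<Prod>e\<in>S. W e)"
    using assms(2) by auto
qed (use assms in auto)

lemma even_card_Diff_eq_0_iff:
  assumes "finite S" "even (card S)"
  shows "card (S - {e}) = 0 \<longleftrightarrow> S = {}"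
proof -
  have "S \<noteq> {e}" using assms(2) by auto
  then show ?thesis using assms(1) by auto
qed

lemma even_card_Diff_eq_1_iff:
  assumes "finite S" "even (card S)"
  shows "card (S - {e}) = 1 \<longleftrightarrow> (\<exists>f. f \<noteq> e \<and> S = {e, f})"
proof
  assume "card (S - {e}) = 1"
  then obtain f where f: "S - {e} = {f}" by (auto simp: card_1_singleton_iff)
  then have "e \<in> S" using assms(2) by (cases "e \<in> S") auto
  with f show "\<exists>f. f \<noteq> e \<and> S = {e, f}" by auto
qed auto

lemma
  assumes B: "finite B" "e \<in> B" "even (card B)" and S: "S \<subseteq> B" "even (card S)"
  shows even_card_Diff_eq_top_iff: "card (S - {e}) = card B - 1 \<longleftrightarrow> S = B"
    and even_card_Diff_eq_subtop_iff: "card (S - {e}) = card B - 2 \<longleftrightarrow> (\<exists>f\<in>B - {e}. S = B - {e, f})"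
proof -
  have fin: "finite S" using B S finite_subset by auto
  have complement: "finite (B - S)" "even (card (B - S))"
    using B S fin by (auto simp: card_Diff_subset card_mono)
  have "B - S - {e} = (B - {e}) - (S - {e})" "S - {e} \<subseteq> B - {e}" using S by auto
  then have "card (B - S - {e}) + card (S - {e}) = card (B - {e})"
    using B(1) fin by (simp add: card_Diff_subset card_mono del: Diff_insert0)
  then have card: "card (B - S - {e}) + card (S - {e}) = card B - 1" using B by simp
  have "card B \<noteq> 0" using B by auto
  then have "2 \<le> card B" using B(3) by presburger
  have "card (S - {e}) = card B - 1 \<longleftrightarrow> card (B - S - {e}) = 0" using card by linarith
  also have "\<dots> \<longleftrightarrow> S = B" unfolding even_card_Diff_eq_0_iff[OF complement] using S by auto
  finally show "card (S - {e}) = card B - 1 \<longleftrightarrow> S = B" .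
  have "card (S - {e}) = card B - 2 \<longleftrightarrow> card (B - S - {e}) = 1" using card \<open>2 \<le> card B\<close> by linarith
  also have "\<dots> \<longleftrightarrow> (\<exists>f. f \<noteq> e \<and> B - S = {e, f})" by (rule even_card_Diff_eq_1_iff[OF complement])
  also have "\<dots> \<longleftrightarrow> (\<exists>f\<in>B - {e}. S = B - {e, f})" using S B(2) by auto
  finally show "card (S - {e}) = card B - 2 \<longleftrightarrow> (\<exists>f\<in>B - {e}. S = B - {e, f})" .
qed

lemma nonreal_quotient_exists:
  assumes "k \<noteq> 0"
  obtains w where "0 < Im w" "Im (k / w) \<noteq> 0"
proof -
  have "Im (k / \<i>) = - Re k" "Im (k / (1 + \<i>)) = (Im k - Re k) / 2"
    by (simp_all add: Im_divide power2_eq_square)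
  moreover have "Re k \<noteq> 0 \<or> Im k - Re k \<noteq> 0" using assms by (auto simp: complex_eq_iff)
  ultimately consider "Im (k / \<i>) \<noteq> 0" | "Im (k / (1 + \<i>)) \<noteq> 0" by fastforce
  then show thesis by cases (auto intro: that[of \<i>] that[of "1 + \<i>"])
qed

definition evenly_supported :: "'e set \<Rightarrow> ('e set \<Rightarrow> 'a::zero) \<Rightarrow> bool"
  where "evenly_supported E c \<longleftrightarrow> (\<forall>S\<subseteq>E. c S \<noteq> 0 \<longrightarrow> even (card S))"

context
  fixes B :: "'e set" and e :: 'e and c :: "'e set \<Rightarrow> 'a::field"
  assumes B: "finite B" "e \<in> B" "even (card B)"
    and parity: "evenly_supported B c"
begin

lemma coeff_even_multiaffine_line:
  assumes "\<S> \<subseteq> Pow B"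
    and "\<And>S. S \<subseteq> B \<Longrightarrow> finite S \<Longrightarrow> even (card S) \<Longrightarrow> card (S - {e}) = i \<longleftrightarrow> S \<in> \<S>"
  shows "coeff (multiaffine_line B (B - {e}) c W) i = (\<Sum>S\<in>\<S>. c S * (\<Prod>f\<in>S. W f))"
proof (rule coeff_multiaffine_line[OF B(1) assms(1)])
  fix S assume S: "S \<subseteq> B" "c S \<noteq> 0"
  then have "S \<inter> (B - {e}) = S - {e}" by auto
  then show "card (S \<inter> (B - {e})) = i \<longleftrightarrow> S \<in> \<S>"
    using assms(2) S parity B(1) finite_subset unfolding evenly_supported_def by metis
qed

lemma coeff_0_multiaffine_line: "coeff (multiaffine_line B (B - {e}) c W) 0 = c {}"
  by (subst coeff_even_multiaffine_line[of "{{}}"])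
    (simp_all add: even_card_Diff_eq_0_iff del: card_0_eq)

lemma coeff_top_multiaffine_line:
  "coeff (multiaffine_line B (B - {e}) c W) (card B - 1) = c B * (\<Prod>f\<in>B. W f)"
  by (subst coeff_even_multiaffine_line[of "{B}"]) (use even_card_Diff_eq_top_iff[OF B] in auto)

lemma degree_multiaffine_line_le: "degree (multiaffine_line B (B - {e}) c W) \<le> card B - 1"
proof (rule degree_le, intro allI impI)
  fix i assume i: "card B - 1 < i"
  have "card (S - {e}) \<noteq> i" if "S \<subseteq> B" for S
  proof -
    have "card (S - {e}) \<le> card (B - {e})" using that B by (intro card_mono) auto
    with i B show ?thesis by simp
  qed
  then show "coeff (multiaffine_line B (B - {e}) c W) i = 0"
    by (subst coeff_even_multiaffine_line[of "{}"]) auto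
qed

lemma coeff_1_multiaffine_line:
  "coeff (multiaffine_line B (B - {e}) c W) 1 = W e * (\<Sum>f\<in>B - {e}. c {e, f} * W f)"
proof -
  have "coeff (multiaffine_line B (B - {e}) c W) 1 =
      (\<Sum>S\<in>(\<lambda>f. {e, f}) ` (B - {e}). c S * (\<Prod>g\<in>S. W g))"
  proof (rule coeff_even_multiaffine_line)
    fix S assume "S \<subseteq> B" "finite S" "even (card S)"
    then show "card (S - {e}) = 1 \<longleftrightarrow> S \<in> (\<lambda>f. {e, f}) ` (B - {e})"
      unfolding even_card_Diff_eq_1_iff[OF \<open>finite S\<close> \<open>even (card S)\<close>] by auto
  qed (use B(2) in auto)
  also have "\<dots> = (\<Sum>f\<in>B - {e}. c {e, f} * (\<Prod>g\<in>{e, f}. W g))"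
    by (subst sum.reindex) (auto simp: inj_on_def doubleton_eq_iff)
  also have "\<dots> = W e * (\<Sum>f\<in>B - {e}. c {e, f} * W f)"
    unfolding sum_distrib_left by (intro sum.cong) auto
  finally show ?thesis .
qed

lemma coeff_subtop_multiaffine_line:
  assumes "\<And>f. f \<in> B - {e} \<Longrightarrow> W f \<noteq> 0"
  shows "coeff (multiaffine_line B (B - {e}) c W) (card B - 2) =
    (\<Prod>f\<in>B - {e}. W f) * (\<Sum>f\<in>B - {e}. c (B - {e, f}) / W f)"
proof -
  have "coeff (multiaffine_line B (B - {e}) c W) (card B - 2) =
      (\<Sum>S\<in>(\<lambda>f. B - {e, f}) ` (B - {e}). c S * (\<Prod>g\<in>S. W g))"
    by (rule coeff_even_multiaffine_line) (use even_card_Diff_eq_subtop_iff[OF B] in auto)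
  also have "\<dots> = (\<Sum>f\<in>B - {e}. c (B - {e, f}) * (\<Prod>g\<in>B - {e, f}. W g))"
    by (subst sum.reindex) (auto simp: inj_on_def)
  also have "\<dots> = (\<Prod>f\<in>B - {e}. W f) * (\<Sum>f\<in>B - {e}. c (B - {e, f}) / W f)"
    unfolding sum_distrib_left
  proof (rule sum.cong[OF refl])
    fix f assume f: "f \<in> B - {e}"
    have "B - {e} - {f} = B - {e, f}" by auto
    then have "(\<Prod>g\<in>B - {e}. W g) = W f * (\<Prod>g\<in>B - {e, f}. W g)"
      using prod.remove[of "B - {e}" f W] f B(1) by simp
    with assms[OF f] show "c (B - {e, f}) * (\<Prod>g\<in>B - {e, f}. W g) =
        (\<Prod>g\<in>B - {e}. W g) * (c (B - {e, f}) / W f)" by simp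
  qed
  finally show ?thesis .
qed

end

lemma multiaffine_pair_sums_valuation_nonreal:
  fixes c :: "'e set \<Rightarrow> complex puiseux"
  assumes B: "finite B" "e \<in> B" and stable: "multiaffine_stable B c"
    and even: "evenly_supported B c" and nz: "c {} \<noteq> 0" "c B \<noteq> 0" and upper: "0 < pIm (W e)"
    and pos: "\<And>f. f \<in> B - {e} \<Longrightarrow> 0 < pRe (W f) \<and> pIm (W f) = 0"
    and nonreal: "Im (leading_coeff (c {} / (c B * (\<Prod>f\<in>B. W f)))) \<noteq> 0"
  shows "valuation (c {}) + valuation (c B)
    \<le> valuation (\<Sum>f\<in>B - {e}. c {e, f} * W f) + valuation (\<Sum>f\<in>B - {e}. c (B - {e, f}) / W f)"
proof -
  define p where "p = multiaffine_line B (B - {e}) c W"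
  define P where "P = (\<Prod>f\<in>B - {e}. W f)"
  define S T where "S = (\<Sum>f\<in>B - {e}. c {e, f} * W f)" and "T = (\<Sum>f\<in>B - {e}. c (B - {e, f}) / W f)"
  have "W f \<noteq> 0" if "f \<in> B" for f using upper pos[of f] that by (cases "f = e") auto
  then have W_nz: "W e \<noteq> 0" "\<And>f. f \<in> B - {e} \<Longrightarrow> W f \<noteq> 0" and "P \<noteq> 0" using B by (auto simp: P_def)
  have "stable_poly p"
    unfolding stable_poly_def
  proof (intro allI impI)
    fix z assume z: "0 < pIm z"
    show "poly p z \<noteq> 0"
      unfolding p_def poly_multiaffine_line[OF B(1)]
      by (rule multiaffine_stableD[OF stable]) (use upper pos z in \<open>auto simp: pIm_mult\<close>)
  qed
  have card_B: "even (card B)" using even nz by (simp add: evenly_supported_def)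
  have bottom: "coeff p 0 = c {}" "coeff p 1 = W e * S"
    unfolding p_def S_def
    by (rule coeff_0_multiaffine_line coeff_1_multiaffine_line; use B card_B even in blast)+
  have subtop: "coeff p (card B - 2) = P * T"
    unfolding p_def P_def T_def by (rule coeff_subtop_multiaffine_line[OF B card_B even W_nz(2)])
  have "(\<Prod>f\<in>B. W f) = W e * P" using B by (simp add: prod.remove[of B e] P_def)
  then have top: "coeff p (card B - 1) = c B * (W e * P)"
    unfolding p_def by (simp only: coeff_top_multiaffine_line[OF B card_B even])
  with nz W_nz(1) \<open>P \<noteq> 0\<close> have "card B - 1 \<le> degree p" by (intro le_degree) simp
  moreover have "degree p \<le> card B - 1"
    unfolding p_def by (rule degree_multiaffine_line_le[OF B card_B even])
  ultimately have deg: "degree p = card B - 1" "degree p - 1 = card B - 2" by auto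
  have "valuation (c {}) + valuation (c B * (W e * P)) \<le> valuation (W e * S) + valuation (P * T)"
    using stable_poly_coeff_valuation[OF \<open>stable_poly p\<close>] nonreal
    unfolding deg(2) subtop unfolding deg(1) top bottom \<open>(\<Prod>f\<in>B. W f) = W e * P\<close> by blast
  then show ?thesis
    unfolding S_def[symmetric] T_def[symmetric] using nz W_nz(1) \<open>P \<noteq> 0\<close>
    by (cases "valuation S"; cases "valuation T") (auto simp: valuation_mult valuation_nonzero)
qed

lemma multiaffine_pair_sums_valuation:
  fixes c :: "'e set \<Rightarrow> complex puiseux"
  assumes B: "finite B" "e \<in> B" and stable: "multiaffine_stable B c"
    and even: "evenly_supported B c" and nz: "c {} \<noteq> 0" "c B \<noteq> 0"
    and pos: "\<And>f. f \<in> B - {e} \<Longrightarrow> 0 < pRe (W f) \<and> pIm (W f) = 0"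
  shows "valuation (c {}) + valuation (c B)
    \<le> valuation (\<Sum>f\<in>B - {e}. c {e, f} * W f) + valuation (\<Sum>f\<in>B - {e}. c (B - {e, f}) / W f)"
proof -
  define P where "P = (\<Prod>f\<in>B - {e}. W f)"
  have "W f \<noteq> 0" if "f \<in> B - {e}" for f using pos[OF that] by auto
  then have "P \<noteq> 0" using B(1) by (simp add: P_def)
  then have "leading_coeff (c {} / (c B * P)) \<noteq> 0" using nz by simp
  then obtain w where w: "0 < Im w" "Im (leading_coeff (c {} / (c B * P)) / w) \<noteq> 0"
    by (rule nonreal_quotient_exists)
  define V where "V = W(e := pconst w)"
  have V: "(\<Prod>f\<in>B - {e}. V f) = P"
    "(\<Sum>f\<in>B - {e}. c {e, f} * V f) = (\<Sum>f\<in>B - {e}. c {e, f} * W f)"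
    "(\<Sum>f\<in>B - {e}. c (B - {e, f}) / V f) = (\<Sum>f\<in>B - {e}. c (B - {e, f}) / W f)"
    unfolding P_def by (rule prod.cong sum.cong; simp add: V_def)+
  have "(\<Prod>f\<in>B. V f) = pconst w * P"
    using prod.remove[OF B, of V] by (simp only: V(1)) (simp add: V_def)
  then have "Im (leading_coeff (c {} / (c B * (\<Prod>f\<in>B. V f)))) \<noteq> 0"
    using w(2) by (simp only: leading_coeff_divide leading_coeff_mult leading_coeff_pmono
        divide_divide_eq_left mult_ac not_False_eq_True)
  then have "valuation (c {}) + valuation (c B)
      \<le> valuation (\<Sum>f\<in>B - {e}. c {e, f} * V f) + valuation (\<Sum>f\<in>B - {e}. c (B - {e, f}) / V f)"
    by (rule multiaffine_pair_sums_valuation_nonreal[OF B stable even nz, rotated 2])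
      (use w(1) pos in \<open>simp_all add: V_def\<close>)
  then show ?thesis by (simp only: V)
qed

lemma ereal_add_less_shift:
  assumes "a \<noteq> \<infinity>" "b \<noteq> \<infinity>" "a + b < ereal M"
  obtains u where "a + ereal u < 0" "b - ereal u < ereal M"
proof (cases "a"; cases "b")
  fix r s assume ab: "a = ereal r" "b = ereal s"
  with assms(3) have "s - M < - r" by simp
  then obtain u where "s - M < u" "u < - r" using dense by blast
  then show thesis using ab by (intro that[of u]) auto
next
  fix s assume "a = - \<infinity>" "b = ereal s"
  then show thesis by (intro that[of "s - M + 1"]) auto
next
  fix r assume "a = ereal r" "b = - \<infinity>"
  then show thesis by (intro that[of "- r - 1"]) auto
qed (use assms that[of 0] in auto)

text \<open>If every exchange failed, the two sums of the preceding lemma could be made small simultaneously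
  by choosing the weights as powers of \<open>t\<close>.\<close>

lemma multiaffine_exchange_empty:
  fixes c :: "'e set \<Rightarrow> complex puiseux"
  assumes B: "finite B" "e \<in> B" and "multiaffine_stable B c" "evenly_supported B c"
    and nz: "c {} \<noteq> 0" "c B \<noteq> 0"
  shows "\<exists>f\<in>B - {e}. valuation (c {}) + valuation (c B)
    \<le> valuation (c {e, f}) + valuation (c (B - {e, f}))"
proof (rule ccontr)
  obtain M where M: "valuation (c {}) + valuation (c B) = ereal M"
    using nz by (simp add: valuation_nonzero)
  assume "\<not> ?thesis"
  then have "\<exists>u. valuation (c {e, f}) + ereal u < 0 \<and> valuation (c (B - {e, f})) - ereal u < ereal M"
    if "f \<in> B - {e}" for f
    using that ereal_add_less_shift[of "valuation (c {e, f})" "valuation (c (B - {e, f}))" M]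
    by (metis M not_le valuation_neq_PInf)
  then obtain u where u: "\<And>f. f \<in> B - {e} \<Longrightarrow> valuation (c {e, f}) + ereal (u f) < 0"
    "\<And>f. f \<in> B - {e} \<Longrightarrow> valuation (c (B - {e, f})) - ereal (u f) < ereal M"
    by metis
  define S T where "S = (\<Sum>f\<in>B - {e}. c {e, f} * pmono 1 (u f))"
    and "T = (\<Sum>f\<in>B - {e}. c (B - {e, f}) / pmono 1 (u f))"
  have "valuation S < ereal 0" "valuation T < ereal M"
    unfolding S_def T_def using u
    by (intro valuation_sum_less;
        simp add: valuation_mult valuation_divide valuation_pmono zero_ereal_def)+
  then have "valuation S + valuation T < ereal M"
    by (cases "valuation S"; cases "valuation T") auto
  moreover have "valuation (c {}) + valuation (c B) \<le> valuation S + valuation T"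
    unfolding S_def T_def by (rule multiaffine_pair_sums_valuation[OF assms]) simp
  ultimately show False using M by simp
qed

lemma card_sym_diff:
  assumes "finite S" "finite A"
  shows "card (sym_diff S A) + 2 * card (S \<inter> A) = card S + card A"
proof -
  have "card (sym_diff S A) = card (S - A) + card (A - S)"
    using assms by (intro card_Un_disjoint) auto
  moreover have "card S = card (S \<inter> A) + card (S - A)" "card A = card (S \<inter> A) + card (A - S)"
    using assms by (metis card_Int_Diff, metis card_Int_Diff Int_commute)
  ultimately show ?thesis by simp
qed

theorem multiaffine_exchange:
  fixes c :: "'e set \<Rightarrow> complex puiseux"
  assumes fin: "finite E" and stable: "multiaffine_stable E c"
    and parity: "\<And>S T. S \<subseteq> E \<Longrightarrow> T \<subseteq> E \<Longrightarrow> c S \<noteq> 0 \<Longrightarrow> c T \<noteq> 0 \<Longrightarrow> even (card S) = even (card T)"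
    and A: "A \<subseteq> E" "c A \<noteq> 0" and B: "B \<subseteq> E" "c B \<noteq> 0" and e: "e \<in> sym_diff A B"
  shows "\<exists>f\<in>sym_diff A B - {e}. valuation (c A) + valuation (c B)
    \<le> valuation (c (sym_diff A {e, f})) + valuation (c (sym_diff B {e, f}))"
proof -
  define D where "D = sym_diff A B"
  define c' where "c' S = (- 1) ^ card (A - S) * c (sym_diff S A)" for S
  have val: "valuation (c' S) = valuation (c (sym_diff S A))" for S
    by (cases "even (card (A - S))") (simp_all add: c'_def)
  have shifts: "sym_diff {} A = A" "sym_diff D A = B" "sym_diff {e, f} A = sym_diff A {e, f}" for f
    by (auto simp: D_def)
  have "D \<subseteq> E" using A B by (auto simp: D_def)
  then have "finite D" using fin by (rule finite_subset)
  have nz: "c' {} \<noteq> 0" "c' D \<noteq> 0" using A B by (simp_all add: c'_def shifts)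
  have "multiaffine_stable E c'"
    unfolding c'_def by (rule multiaffine_stable_reflect[OF fin stable A(1)])
  then have "multiaffine_stable D c'"
    using multiaffine_stable_subset[OF fin] \<open>D \<subseteq> E\<close> nz by blast
  moreover have "evenly_supported D c'"
    unfolding evenly_supported_def
  proof (intro allI impI)
    fix S assume S: "S \<subseteq> D" "c' S \<noteq> 0"
    then have fins: "finite S" "finite A" using \<open>finite D\<close> A fin finite_subset by blast+
    have "sym_diff S A \<subseteq> E" "c (sym_diff S A) \<noteq> 0" using S A \<open>D \<subseteq> E\<close> by (auto simp: c'_def)
    then have "even (card (sym_diff S A)) = even (card A)"
      using parity A by blast
    then show "even (card S)" using card_sym_diff[OF fins] by presburger
  qed
  ultimately obtain f where f: "f \<in> D - {e}"
    "valuation (c' {}) + valuation (c' D) \<le> valuation (c' {e, f}) + valuation (c' (D - {e, f}))"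
    using multiaffine_exchange_empty[of D e c'] \<open>finite D\<close> e nz by (auto simp: D_def)
  moreover have "sym_diff (D - {e, f}) A = sym_diff B {e, f}"
    using f(1) e by (auto simp: D_def)
  ultimately show ?thesis unfolding val shifts D_def[symmetric] by auto
qed


section \<open>Polarization\<close>

definition nonvanishing_functional :: "nat \<Rightarrow> (nat \<Rightarrow> complex puiseux) \<Rightarrow> bool"
  where "nonvanishing_functional k l \<longleftrightarrow>
    (\<forall>p. stable_poly p \<longrightarrow> degree p \<le> k \<longrightarrow> (\<Sum>i\<le>k. coeff p i * l i) \<noteq> 0)"

lemma nonvanishing_functional_esym:
  assumes "\<And>i. i < k \<Longrightarrow> 0 < pIm (z i)"
  shows "nonvanishing_functional k (\<lambda>i. esym {..<k} z i / of_nat (k choose i))"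
  using grace_walsh_szego[of "{..<k}" _ z] assms by (simp add: nonvanishing_functional_def)

lemma nonvanishing_functional_apply:
  assumes "finite \<Gamma>" and bound: "\<And>\<gamma>. \<gamma> \<in> \<Gamma> \<Longrightarrow> d \<gamma> \<le> k"
    and nv: "\<And>x. 0 < pIm x \<Longrightarrow> (\<Sum>\<gamma>\<in>\<Gamma>. r \<gamma> * x ^ d \<gamma>) \<noteq> 0"
    and l: "nonvanishing_functional k l"
  shows "(\<Sum>\<gamma>\<in>\<Gamma>. r \<gamma> * l (d \<gamma>)) \<noteq> 0"
proof -
  define p where "p = (\<Sum>\<gamma>\<in>\<Gamma>. monom (r \<gamma>) (d \<gamma>))"
  have "stable_poly p" using nv by (simp add: stable_poly_def p_def poly_sum poly_monom)
  moreover have "degree p \<le> k"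
    unfolding p_def using assms(1) bound
    by (intro degree_sum_le) (auto intro: order_trans[OF degree_monom_le])
  ultimately have "(\<Sum>i\<le>k. coeff p i * l i) \<noteq> 0"
    using l by (simp add: nonvanishing_functional_def)
  also have "(\<Sum>i\<le>k. coeff p i * l i) = (\<Sum>\<gamma>\<in>\<Gamma>. \<Sum>i\<le>k. if d \<gamma> = i then r \<gamma> * l i else 0)"
    unfolding p_def coeff_sum sum_distrib_right by (subst sum.swap) (auto intro!: sum.cong)
  also have "\<dots> = (\<Sum>\<gamma>\<in>\<Gamma>. r \<gamma> * l (d \<gamma>))"
    using bound by (intro sum.cong) auto
  finally show ?thesis .
qed

lemma nonvanishing_functionals_tensor:
  fixes a :: "nat ^ 'n::finite \<Rightarrow> complex puiseux"
  assumes fin: "finite \<Gamma>" and bound: "\<And>\<gamma> j. \<gamma> \<in> \<Gamma> \<Longrightarrow> \<gamma> $ j \<le> k"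
    and nv: "\<And>z. (\<And>j. 0 < pIm (z j)) \<Longrightarrow> (\<Sum>\<gamma>\<in>\<Gamma>. a \<gamma> * (\<Prod>j\<in>UNIV. z j ^ (\<gamma> $ j))) \<noteq> 0"
    and l: "\<And>j. nonvanishing_functional k (l j)"
  shows "(\<Sum>\<gamma>\<in>\<Gamma>. a \<gamma> * (\<Prod>j\<in>UNIV. l j (\<gamma> $ j))) \<noteq> 0"
proof -
  have "(\<Sum>\<gamma>\<in>\<Gamma>. a \<gamma> * (\<Prod>j\<in>UNIV. l j (\<gamma> $ j))) \<noteq> 0"
    if "finite J" "\<And>j. j \<in> J \<Longrightarrow> nonvanishing_functional k (l j)"
      "\<And>j. j \<notin> J \<Longrightarrow> \<exists>x. 0 < pIm x \<and> l j = (\<lambda>i. x ^ i)" for J l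
    using that
  proof (induction J arbitrary: l rule: finite_induct)
    case empty
    then obtain z where "\<And>j. 0 < pIm (z j)" "\<And>j. l j = (\<lambda>i. z j ^ i)" by (metis empty_iff)
    with nv[of z] show ?case by simp
  next
    case (insert m J)
    define r where "r \<gamma> = a \<gamma> * (\<Prod>j\<in>UNIV - {m}. l j (\<gamma> $ j))" for \<gamma>
    have split: "a \<gamma> * (\<Prod>j\<in>UNIV. (l(m := h)) j (\<gamma> $ j)) = r \<gamma> * h (\<gamma> $ m)" for \<gamma> h
    proof -
      have "(\<Prod>j\<in>UNIV - {m}. (l(m := h)) j (\<gamma> $ j)) = (\<Prod>j\<in>UNIV - {m}. l j (\<gamma> $ j))"
        by (intro prod.cong) auto
      then show ?thesis by (simp add: prod.remove[of UNIV m] r_def mult_ac)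
    qed
    have eval: "(\<Sum>\<gamma>\<in>\<Gamma>. r \<gamma> * x ^ (\<gamma> $ m)) \<noteq> 0" if "0 < pIm x" for x
    proof -
      have "(\<Sum>\<gamma>\<in>\<Gamma>. a \<gamma> * (\<Prod>j\<in>UNIV. (l(m := \<lambda>i. x ^ i)) j (\<gamma> $ j))) \<noteq> 0"
        by (rule insert.IH[of "l(m := \<lambda>i. x ^ i)"]) (use insert.prems insert.hyps that in auto)
      then show ?thesis by (simp only: split not_False_eq_True)
    qed
    have "(\<Sum>\<gamma>\<in>\<Gamma>. r \<gamma> * l m (\<gamma> $ m)) \<noteq> 0"
      by (rule nonvanishing_functional_apply[where d = "\<lambda>\<gamma>. \<gamma> $ m" and l = "l m", OF fin])
        (use bound eval insert.prems(1) in auto)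
    then show ?case using split[of _ "l m"] by simp
  qed
  from this[of UNIV l] l show ?thesis by simp
qed

text \<open>The pair \<open>(j, i)\<close> stands for the \<open>i\<close>-th copy of the variable \<open>z\<^sub>j\<close>.\<close>

definition fibre_card :: "('n::finite \<times> nat) set \<Rightarrow> nat ^ 'n"
  where "fibre_card S = (\<chi> j. card {i. (j, i) \<in> S})"

definition polarization :: "nat \<Rightarrow> (nat ^ 'n::finite \<Rightarrow> 'a::field_char_0) \<Rightarrow> ('n \<times> nat) set \<Rightarrow> 'a"
  where "polarization k a S = a (fibre_card S) / of_nat (\<Prod>j\<in>UNIV. k choose (fibre_card S $ j))"

lemma fibre_card_le: "S \<subseteq> UNIV \<times> {..<k} \<Longrightarrow> fibre_card S $ j \<le> k"
  using card_mono[of "{..<k}" "{i. (j, i) \<in> S}"] by (auto simp: fibre_card_def)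

lemma prod_esym:
  fixes Z :: "'n::finite \<times> nat \<Rightarrow> 'a::comm_ring_1"
  shows "(\<Prod>j\<in>UNIV. esym {..<k} (\<lambda>i. Z (j, i)) (\<gamma> $ j)) =
    (\<Sum>S\<in>Pow (UNIV \<times> {..<k}). if fibre_card S = \<gamma> then \<Prod>e\<in>S. Z e else 0)"
proof -
  let ?t = "\<lambda>T j. if card (T j) = \<gamma> $ j then \<Prod>i\<in>T j. Z (j, i) else 0"
  have "(\<Prod>j\<in>UNIV. esym {..<k} (\<lambda>i. Z (j, i)) (\<gamma> $ j)) =
      (\<Sum>T\<in>PiE UNIV (\<lambda>_. Pow {..<k}). \<Prod>j\<in>UNIV. ?t T j)"
    unfolding esym_def by (rule prod_sum_PiE) auto
  also have "\<dots> = (\<Sum>S\<in>Pow (UNIV \<times> {..<k}). if fibre_card S = \<gamma> then \<Prod>e\<in>S. Z e else 0)"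
  proof (rule sum.reindex_bij_witness[of _ "\<lambda>S j. {i. (j, i) \<in> S}" "\<lambda>T. Sigma UNIV T"])
    fix T :: "'n \<Rightarrow> nat set" assume T: "T \<in> PiE UNIV (\<lambda>_. Pow {..<k})"
    then have fin: "finite (T j)" for j
      by (metis PiE_mem Pow_iff UNIV_I finite_lessThan finite_subset)
    show "(if fibre_card (Sigma UNIV T) = \<gamma> then \<Prod>e\<in>Sigma UNIV T. Z e else 0) = (\<Prod>j\<in>UNIV. ?t T j)"
    proof (cases "fibre_card (Sigma UNIV T) = \<gamma>")
      case True
      then have "card (T j) = \<gamma> $ j" for j by (auto simp: fibre_card_def)
      moreover have "(\<Prod>e\<in>Sigma UNIV T. Z e) = (\<Prod>j\<in>UNIV. \<Prod>i\<in>T j. Z (j, i))"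
        using fin by (subst prod.Sigma) auto
      ultimately show ?thesis using True by simp
    next
      case False
      then obtain j where "card (T j) \<noteq> \<gamma> $ j" by (auto simp: fibre_card_def vec_eq_iff)
      then have "(\<Prod>j\<in>UNIV. ?t T j) = 0" by (intro prod_zero) (auto intro!: bexI[of _ j])
      with False show ?thesis by simp
    qed
  qed (auto simp: PiE_iff)
  finally show ?thesis .
qed

lemma multiaffine_eval_polarization:
  fixes Z :: "'n::finite \<times> nat \<Rightarrow> 'a::field_char_0"
  assumes "finite \<Gamma>" "\<And>\<gamma>. a \<gamma> \<noteq> 0 \<Longrightarrow> \<gamma> \<in> \<Gamma>"
  shows "multiaffine_eval (UNIV \<times> {..<k}) (polarization k a) Z =
    (\<Sum>\<gamma>\<in>\<Gamma>. a \<gamma> * (\<Prod>j\<in>UNIV. esym {..<k} (\<lambda>i. Z (j, i)) (\<gamma> $ j) / of_nat (k choose (\<gamma> $ j))))"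
proof -
  let ?E = "UNIV \<times> {..<k} :: ('n \<times> nat) set"
  define b where "b \<gamma> = a \<gamma> / of_nat (\<Prod>j\<in>UNIV. k choose (\<gamma> $ j))" for \<gamma> :: "nat ^ 'n"
  have b_eq_0: "b \<gamma> = 0" if "\<gamma> \<notin> \<Gamma>" for \<gamma> using assms(2) that by (auto simp: b_def)
  have "(\<Sum>\<gamma>\<in>\<Gamma>. a \<gamma> * (\<Prod>j\<in>UNIV. esym {..<k} (\<lambda>i. Z (j, i)) (\<gamma> $ j) / of_nat (k choose (\<gamma> $ j)))) =
      (\<Sum>\<gamma>\<in>\<Gamma>. b \<gamma> * (\<Sum>S\<in>Pow ?E. if fibre_card S = \<gamma> then \<Prod>e\<in>S. Z e else 0))"
    by (simp add: b_def prod_dividef flip: prod_esym)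
  also have "\<dots> = (\<Sum>S\<in>Pow ?E. \<Sum>\<gamma>\<in>\<Gamma>. if fibre_card S = \<gamma> then b \<gamma> * (\<Prod>e\<in>S. Z e) else 0)"
    unfolding sum_distrib_left by (subst sum.swap) (auto intro!: sum.cong)
  also have "\<dots> = (\<Sum>S\<in>Pow ?E. b (fibre_card S) * (\<Prod>e\<in>S. Z e))"
    using assms(1) b_eq_0 by (intro sum.cong) auto
  finally show ?thesis by (simp add: multiaffine_eval_def polarization_def b_def)
qed

lemma valuation_power_eq_0: "valuation x = 0 \<Longrightarrow> valuation (x ^ n) = 0"
  for x :: "'a::idom puiseux"
  by (induction n) (simp_all add: valuation_mult)

lemma pconst_cis_mult_half_plane:
  assumes "0 < pIm z"
  shows "pconst (cis (- \<theta>)) * z \<in> half_plane \<theta>"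
proof -
  have "pconst (exp (\<i> * complex_of_real \<theta>)) * (pconst (cis (- \<theta>)) * z) = z"
    by (simp add: mult.assoc[symmetric] pmono_mult cis_conv_exp[symmetric] cis_mult pconst_1)
  with assms show ?thesis unfolding half_plane_def puiseux_pos_iff by (simp only: mem_Collect_eq)
qed

theorem half_plane_property_polarization:
  fixes P :: "(complex puiseux, 'n::finite) mpol"
  assumes "half_plane_property P" and bound: "\<And>\<gamma> j. Poly_Mapping.lookup P \<gamma> \<noteq> 0 \<Longrightarrow> \<gamma> $ j \<le> k"
  obtains c where "multiaffine_stable (UNIV \<times> {..<k}) c"
    "\<And>S. S \<subseteq> UNIV \<times> {..<k} \<Longrightarrow> valuation (c S) = valuation (Poly_Mapping.lookup P (fibre_card S))"
proof -
  obtain \<theta> where \<theta>: "half_plane_stable \<theta> P" using assms(1) by (auto simp: half_plane_property_def)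
  define w :: "complex puiseux" where "w = pconst (cis (- \<theta>))"
  define a where "a \<gamma> = Poly_Mapping.lookup P \<gamma> * (\<Prod>j\<in>UNIV. w ^ (\<gamma> $ j))" for \<gamma>
  show thesis
  proof
    show "multiaffine_stable (UNIV \<times> {..<k}) (polarization k a)"
    proof (rule multiaffine_stableI)
      fix Z :: "'n \<times> nat \<Rightarrow> complex puiseux" assume Z: "\<And>e. e \<in> UNIV \<times> {..<k} \<Longrightarrow> 0 < pIm (Z e)"
      define l where "l j i = esym {..<k} (\<lambda>i. Z (j, i)) i / of_nat (k choose i)" for j i
      have "(\<Sum>\<gamma>\<in>Poly_Mapping.keys P. a \<gamma> * (\<Prod>j\<in>UNIV. l j (\<gamma> $ j))) \<noteq> 0"
      proof (rule nonvanishing_functionals_tensor)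
        show "(\<Sum>\<gamma>\<in>Poly_Mapping.keys P. a \<gamma> * (\<Prod>j\<in>UNIV. z j ^ (\<gamma> $ j))) \<noteq> 0"
          if "\<And>j. 0 < pIm (z j)" for z
        proof -
          have "mpol_eval P (\<chi> j. w * z j) \<noteq> 0"
            using \<theta> that pconst_cis_mult_half_plane by (simp add: half_plane_stable_def w_def)
          then show ?thesis
            by (simp add: mpol_eval_def a_def power_mult_distrib prod.distrib mult.assoc)
        qed
        show "nonvanishing_functional k (l j)" for j
          unfolding l_def using Z by (intro nonvanishing_functional_esym) simp
      qed (use bound in \<open>auto simp: in_keys_iff\<close>)
      then show "multiaffine_eval (UNIV \<times> {..<k}) (polarization k a) Z \<noteq> 0"
        unfolding l_def by (subst multiaffine_eval_polarization) (auto simp: a_def in_keys_iff)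
    qed
  next
    fix S :: "('n \<times> nat) set" assume "S \<subseteq> UNIV \<times> {..<k}"
    then have "(\<Prod>j\<in>UNIV. k choose (fibre_card S $ j)) \<noteq> 0"
      by (simp add: not_less fibre_card_le)
    moreover have "valuation w = 0" by (simp add: w_def valuation_pmono)
    ultimately
    show "valuation (polarization k a S) = valuation (Poly_Mapping.lookup P (fibre_card S))"
      by (simp add: polarization_def a_def valuation_divide valuation_mult valuation_prod
          valuation_power_eq_0 del: of_nat_prod)
  qed
qed


section \<open>Steps and M-concavity\<close>

lemma l1_add_axis: "l1 (x + axis j d) = l1 x - \<bar>x $ j\<bar> + \<bar>x $ j + d\<bar>"
proof -
  have "l1 (x + axis j d) = \<bar>x $ j + d\<bar> + (\<Sum>i\<in>UNIV - {j}. \<bar>(x + axis j d) $ i\<bar>)"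
    unfolding l1_def by (subst sum.remove[of _ j]) (auto simp: axis_def)
  also have "(\<Sum>i\<in>UNIV - {j}. \<bar>(x + axis j d) $ i\<bar>) = (\<Sum>i\<in>UNIV - {j}. \<bar>x $ i\<bar>)"
    by (intro sum.cong) (auto simp: axis_def)
  also have "\<dots> = l1 x - \<bar>x $ j\<bar>"
    unfolding l1_def by (subst (2) sum.remove[of _ j]) auto
  finally show ?thesis by simp
qed

lemma l1_eq_1E:
  assumes "l1 s = 1"
  obtains j d where "\<bar>d\<bar> = 1" "s = axis j d"
proof -
  have "\<exists>j. s $ j \<noteq> 0"
    using assms by (rule contrapos_pp) (simp add: l1_def)
  then obtain j where j: "s $ j \<noteq> 0" by blast
  have "l1 s = \<bar>s $ j\<bar> + (\<Sum>i\<in>UNIV - {j}. \<bar>s $ i\<bar>)"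
    unfolding l1_def by (subst sum.remove[of _ j]) auto
  moreover have "0 \<le> (\<Sum>i\<in>UNIV - {j}. \<bar>s $ i\<bar>)" by (rule sum_nonneg) simp
  ultimately have "\<bar>s $ j\<bar> = 1" and rest: "(\<Sum>i\<in>UNIV - {j}. \<bar>s $ i\<bar>) = 0"
    using assms j by linarith+
  moreover from rest have "s $ i = 0" if "i \<noteq> j" for i
    using that by (subst (asm) sum_nonneg_eq_0_iff) auto
  then have "s = axis j (s $ j)" by (auto simp: vec_eq_iff axis_def)
  ultimately show thesis using that by blast
qed

lemma is_step_axis_iff:
  assumes "\<bar>d\<bar> = 1"
  shows "is_step \<alpha> (axis j d) \<beta> \<longleftrightarrow> 0 < d * (\<beta> $ j - \<alpha> $ j)"
proof -
  have "l1 (axis j d) = 1" using l1_add_axis[of 0 j d] assms by (simp add: l1_def)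
  moreover have "l1 (\<alpha> + axis j d - \<beta>) = l1 (\<alpha> - \<beta>) - \<bar>\<alpha> $ j - \<beta> $ j\<bar> + \<bar>\<alpha> $ j - \<beta> $ j + d\<bar>"
    using l1_add_axis[of "\<alpha> - \<beta>" j d] by (simp add: algebra_simps)
  moreover have "d = 1 \<or> d = - 1" using assms by arith
  ultimately show ?thesis unfolding is_step_def by auto
qed

definition int_vec :: "nat ^ 'n \<Rightarrow> int ^ 'n"
  where "int_vec \<gamma> = (\<chi> i. int (\<gamma> $ i))"

abbreviation int_fibre_card :: "('n::finite \<times> nat) set \<Rightarrow> int ^ 'n"
  where "int_fibre_card S \<equiv> int_vec (fibre_card S)"

definition initial_segments :: "nat ^ 'n \<Rightarrow> ('n \<times> nat) set"
  where "initial_segments \<gamma> = {(j, i). i < \<gamma> $ j}"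

lemma fibre_card_initial_segments [simp]: "fibre_card (initial_segments \<gamma>) = \<gamma>"
  by (simp add: fibre_card_def initial_segments_def vec_eq_iff)

lemma finite_initial_segments: "finite (initial_segments (\<gamma> :: nat ^ 'n::finite))"
proof -
  have "initial_segments \<gamma> = (SIGMA j:UNIV. {..<\<gamma> $ j})" by (auto simp: initial_segments_def)
  then show ?thesis by simp
qed

definition toggle_step :: "('n::finite \<times> nat) set \<Rightarrow> 'n \<times> nat \<Rightarrow> int ^ 'n"
  where "toggle_step S e = axis (fst e) (if e \<in> S then - 1 else 1)"

lemma finite_fibre: "finite S \<Longrightarrow> finite {i. (j, i) \<in> S}"
  by (rule finite_subset[of _ "snd ` S"]) force+

lemma l1_int_fibre_card:
  assumes "finite S"
  shows "l1 (int_fibre_card S) = int (card S)"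
proof -
  have "S = (SIGMA j:UNIV. {i. (j, i) \<in> S})" by auto
  then have "card S = (\<Sum>j\<in>UNIV. card {i. (j, i) \<in> S})"
    using card_SigmaI[of UNIV "\<lambda>j. {i. (j, i) \<in> S}"] finite_fibre[OF assms] by simp
  then show ?thesis by (simp add: l1_def int_vec_def fibre_card_def)
qed

lemma int_fibre_card_toggle:
  assumes "finite S"
  shows "int_fibre_card (sym_diff S {e}) = int_fibre_card S + toggle_step S e"
proof -
  obtain l m where e: "e = (l, m)" by (cases e)
  have "int (card {i. (j, i) \<in> sym_diff S {e}}) =
      int (card {i. (j, i) \<in> S}) + axis l (if e \<in> S then - 1 else 1) $ j" for j
  proof -
    note fin = finite_fibre[OF assms, of j]
    consider (other_fibre) "j \<noteq> l" | (removed) "j = l" "e \<in> S" | (inserted) "j = l" "e \<notin> S" by blast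
    then show ?thesis
    proof cases
      case other_fibre
      then have "{i. (j, i) \<in> sym_diff S {e}} = {i. (j, i) \<in> S}" by (auto simp: e)
      with other_fibre show ?thesis by (simp add: axis_def)
    next
      case removed
      then have "{i. (j, i) \<in> sym_diff S {e}} = {i. (j, i) \<in> S} - {m}" "m \<in> {i. (j, i) \<in> S}"
        by (auto simp: e)
      moreover from this(2) have "card {i. (j, i) \<in> S} \<noteq> 0" using fin by auto
      ultimately show ?thesis using removed fin by (simp add: axis_def)
    next
      case inserted
      then have "{i. (j, i) \<in> sym_diff S {e}} = insert m {i. (j, i) \<in> S}" "m \<notin> {i. (j, i) \<in> S}"
        by (auto simp: e)
      with inserted fin show ?thesis by (simp add: axis_def)
    qed
  qed
  then show ?thesis by (simp add: vec_eq_iff int_vec_def fibre_card_def toggle_step_def e)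
qed

lemma int_fibre_card_toggle2:
  assumes "finite S" "e \<noteq> f"
  shows "int_fibre_card (sym_diff S {e, f}) =
    int_fibre_card S + toggle_step S e + toggle_step S f"
proof -
  have "sym_diff S {e, f} = sym_diff (sym_diff S {e}) {f}" using assms(2) by auto
  moreover have "toggle_step (sym_diff S {e}) f = toggle_step S f"
    using assms(2) by (simp add: toggle_step_def)
  ultimately show ?thesis
    using assms(1) by (simp only: int_fibre_card_toggle finite_Un finite_Diff finite.intros)
qed

lemma toggle_step_opposite:
  assumes "e \<in> sym_diff A B"
  shows "toggle_step B e = - toggle_step A e"
  using assms by (auto simp: toggle_step_def vec_eq_iff axis_def)

lemma is_step_initial_segmentsE:
  assumes "is_step (int_vec \<alpha>) s (int_vec \<beta>)"
  obtains e where "e \<in> sym_diff (initial_segments \<alpha>) (initial_segments \<beta>)"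
    "s = toggle_step (initial_segments \<alpha>) e"
proof -
  obtain j d where d: "\<bar>d\<bar> = 1" and s: "s = axis j d"
    using assms l1_eq_1E[of s] unfolding is_step_def by metis
  from assms have "0 < d * (int (\<beta> $ j) - int (\<alpha> $ j))"
    unfolding s is_step_axis_iff[OF d] by (simp add: int_vec_def)
  moreover from d have "d = 1 \<or> d = - 1" by arith
  ultimately show thesis
    by (intro that[of "(j, if d = 1 then \<alpha> $ j else \<alpha> $ j - 1)"])
      (auto simp: s initial_segments_def toggle_step_def)
qed

lemma is_step_toggle2:
  assumes "e \<in> sym_diff (initial_segments \<alpha>) (initial_segments \<beta>)"
    "f \<in> sym_diff (initial_segments \<alpha>) (initial_segments \<beta>) - {e}"
  shows "is_step (int_vec \<alpha> + toggle_step (initial_segments \<alpha>) e)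
    (toggle_step (initial_segments \<alpha>) f) (int_vec \<beta>)"
proof -
  obtain j i l m where ef: "e = (j, i)" "f = (l, m)" by (cases e, cases f)
  have axis_component: "axis j d $ l = (if l = j then d else 0)" for d :: int by (simp add: axis_def)
  from assms show ?thesis
    by (auto simp: ef toggle_step_def is_step_axis_iff axis_component initial_segments_def int_vec_def)
qed

lemma M_concaveI_fibre_card:
  fixes J :: "(int ^ 'n::finite) set" and g :: "int ^ 'n \<Rightarrow> real"
  assumes J: "J \<subseteq> range int_vec"
    and exchange: "\<And>A B e. finite A \<Longrightarrow> finite B \<Longrightarrow>
      int_fibre_card A \<in> J \<Longrightarrow> int_fibre_card B \<in> J \<Longrightarrow> e \<in> sym_diff A B \<Longrightarrow>
      \<exists>f\<in>sym_diff A B - {e}. int_fibre_card (sym_diff A {e, f}) \<in> J \<and>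
        int_fibre_card (sym_diff B {e, f}) \<in> J \<and>
        g (int_fibre_card A) + g (int_fibre_card B)
          \<le> g (int_fibre_card (sym_diff A {e, f})) + g (int_fibre_card (sym_diff B {e, f}))"
  shows "M_concave J g"
  unfolding M_concave_def
proof (intro ballI allI impI)
  fix \<alpha>' \<beta>' s assume \<alpha>': "\<alpha>' \<in> J" and \<beta>': "\<beta>' \<in> J" and step: "is_step \<alpha>' s \<beta>'"
  obtain \<alpha> \<beta> where \<alpha>: "\<alpha>' = int_vec \<alpha>" and \<beta>: "\<beta>' = int_vec \<beta>" using J \<alpha>' \<beta>' by blast
  let ?A = "initial_segments \<alpha>" and ?B = "initial_segments \<beta>"
  obtain e where e: "e \<in> sym_diff ?A ?B" and s: "s = toggle_step ?A e"
    using step unfolding \<alpha> \<beta> by (rule is_step_initial_segmentsE)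
  obtain f where f: "f \<in> sym_diff ?A ?B - {e}"
    and exchanged: "int_fibre_card (sym_diff ?A {e, f}) \<in> J" "int_fibre_card (sym_diff ?B {e, f}) \<in> J"
      "g \<alpha>' + g \<beta>'
        \<le> g (int_fibre_card (sym_diff ?A {e, f})) + g (int_fibre_card (sym_diff ?B {e, f}))"
    using exchange[OF finite_initial_segments finite_initial_segments _ _ e] \<alpha>' \<beta>'
    by (auto simp: \<alpha> \<beta>)
  define t where "t = toggle_step ?A f"
  have "int_fibre_card (sym_diff ?A {e, f}) = \<alpha>' + s + t"
    using f by (subst int_fibre_card_toggle2) (auto simp: finite_initial_segments \<alpha> s t_def)
  moreover have "int_fibre_card (sym_diff ?B {e, f}) = \<beta>' - s - t"
    using e f toggle_step_opposite[of _ ?A ?B]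
    by (subst int_fibre_card_toggle2) (auto simp: finite_initial_segments \<beta> s t_def)
  moreover have "is_step (\<alpha>' + s) t \<beta>'"
    using is_step_toggle2[OF e f] by (simp add: \<alpha> \<beta> s t_def)
  ultimately show "\<exists>t. is_step (\<alpha>' + s) t \<beta>' \<and> \<alpha>' + s + t \<in> J \<and> \<beta>' - s - t \<in> J \<and>
      g \<alpha>' + g \<beta>' \<le> g (\<alpha>' + s + t) + g (\<beta>' - s - t)"
    using exchanged by auto
qed

lemma int_vec_in_supp_iff: "int_vec \<gamma> \<in> supp P \<longleftrightarrow> Poly_Mapping.lookup P \<gamma> \<noteq> 0"
  for \<gamma> :: "nat ^ 'n::finite"
proof -
  have "inj (int_vec :: nat ^ 'n \<Rightarrow> int ^ 'n)" by (rule injI) (simp add: int_vec_def vec_eq_iff)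
  moreover have "supp P = int_vec ` {\<delta>. Poly_Mapping.lookup P \<delta> \<noteq> 0}"
    by (simp add: supp_def int_vec_def)
  ultimately show ?thesis by (simp add: inj_image_mem_iff)
qed

lemma supp_subset_range_int_vec: "supp P \<subseteq> range int_vec"
  by (auto simp: supp_def int_vec_def)

lemma trop_int_vec: "trop P (int_vec \<gamma>) = real_of_ereal (valuation (Poly_Mapping.lookup P \<gamma>))"
  by (simp add: trop_def int_vec_def)

lemma valuation_add_leD:
  assumes "x \<noteq> 0" "y \<noteq> 0" and sum_le: "valuation x + valuation y \<le> valuation x' + valuation y'"
  shows "x' \<noteq> 0" "y' \<noteq> 0"
    and "real_of_ereal (valuation x) + real_of_ereal (valuation y)
      \<le> real_of_ereal (valuation x') + real_of_ereal (valuation y')"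
proof -
  have "x' \<noteq> 0 \<and> y' \<noteq> 0 \<and> real_of_ereal (valuation x) + real_of_ereal (valuation y)
      \<le> real_of_ereal (valuation x') + real_of_ereal (valuation y')"
    using assms by (cases "valuation x'"; cases "valuation y'") (auto simp: valuation_nonzero)
  then show "x' \<noteq> 0" "y' \<noteq> 0" "real_of_ereal (valuation x) + real_of_ereal (valuation y)
      \<le> real_of_ereal (valuation x') + real_of_ereal (valuation y')" by auto
qed

lemma valuation_exchange:
  fixes P :: "(complex puiseux, 'n::finite) mpol"
  assumes P: "constant_parity (supp P)" "half_plane_property P" and fin: "finite A" "finite B"
    and A: "int_fibre_card A \<in> supp P" and B: "int_fibre_card B \<in> supp P"
    and e: "e \<in> sym_diff A B"
  defines "\<nu> \<equiv> \<lambda>S. valuation (Poly_Mapping.lookup P (fibre_card S))"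
  shows "\<exists>f\<in>sym_diff A B - {e}. \<nu> A + \<nu> B \<le> \<nu> (sym_diff A {e, f}) + \<nu> (sym_diff B {e, f})"
proof -
  define K where "K = (\<lambda>(\<gamma>, j). \<gamma> $ j) ` (Poly_Mapping.keys P \<times> UNIV) \<union> snd ` (A \<union> B)"
  have "finite K" using fin by (simp add: K_def)
  then obtain k where k: "\<And>i. i \<in> K \<Longrightarrow> i < k"
    unfolding finite_nat_set_iff_bounded by blast
  let ?E = "UNIV \<times> {..<k} :: ('n \<times> nat) set"
  have "\<gamma> $ j \<le> k" if "Poly_Mapping.lookup P \<gamma> \<noteq> 0" for \<gamma> j
    using k[of "\<gamma> $ j"] that by (force simp: K_def in_keys_iff)
  then obtain c where stable: "multiaffine_stable ?E c"
    and val_c: "\<And>S. S \<subseteq> ?E \<Longrightarrow> valuation (c S) = \<nu> S"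
    using half_plane_property_polarization[OF P(2)] unfolding \<nu>_def by metis
  have AB: "A \<subseteq> ?E" "B \<subseteq> ?E" using k by (force simp: K_def)+
  have nz: "c S \<noteq> 0 \<longleftrightarrow> int_fibre_card S \<in> supp P" if "S \<subseteq> ?E" for S
    using val_c[OF that] by (metis \<nu>_def int_vec_in_supp_iff valuation_eq_MInf_iff)
  have parity: "even (card S) = even (card T)" if "S \<subseteq> ?E" "T \<subseteq> ?E" "c S \<noteq> 0" "c T \<noteq> 0" for S T
  proof -
    have "finite S" "finite T" using that finite_subset[of _ ?E] by auto
    moreover have "even (l1 (int_fibre_card S) - l1 (int_fibre_card T))"
      using P(1) nz that unfolding constant_parity_def by blast
    ultimately show ?thesis by (simp add: l1_int_fibre_card)
  qed
  obtain f where f: "f \<in> sym_diff A B - {e}" "valuation (c A) + valuation (c B)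
      \<le> valuation (c (sym_diff A {e, f})) + valuation (c (sym_diff B {e, f}))"
    using multiaffine_exchange[OF _ stable parity AB(1) _ AB(2) _ e] nz AB A B by auto
  moreover have "sym_diff A {e, f} \<subseteq> ?E" "sym_diff B {e, f} \<subseteq> ?E" using e f(1) AB by auto
  ultimately show ?thesis using AB by (auto simp: val_c)
qed

theorem theorem1p5:
  fixes P :: "(complex puiseux, 'n::finite) mpol"
  assumes "constant_parity (supp P)"
    and "half_plane_property P"
  shows "M_concave (supp P) (trop P)"
proof (rule M_concaveI_fibre_card[OF supp_subset_range_int_vec])
  fix A B :: "('n \<times> nat) set" and e
  assume "finite A" "finite B"
    and supp: "int_fibre_card A \<in> supp P" "int_fibre_card B \<in> supp P"
    and "e \<in> sym_diff A B"
  with assms obtain f where f: "f \<in> sym_diff A B - {e}"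
    and exchange: "valuation (Poly_Mapping.lookup P (fibre_card A)) +
        valuation (Poly_Mapping.lookup P (fibre_card B))
      \<le> valuation (Poly_Mapping.lookup P (fibre_card (sym_diff A {e, f}))) +
        valuation (Poly_Mapping.lookup P (fibre_card (sym_diff B {e, f})))"
    using valuation_exchange by blast
  from valuation_add_leD[OF _ _ exchange] supp f
  show "\<exists>f\<in>sym_diff A B - {e}. int_fibre_card (sym_diff A {e, f}) \<in> supp P \<and>
      int_fibre_card (sym_diff B {e, f}) \<in> supp P \<and>
      trop P (int_fibre_card A) + trop P (int_fibre_card B)
        \<le> trop P (int_fibre_card (sym_diff A {e, f})) + trop P (int_fibre_card (sym_diff B {e, f}))"
    unfolding int_vec_in_supp_iff trop_int_vec by blast
qed

end
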